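(* Let $(X,d,\mu)$ be a complete geodesic metric measure space with $\mu$ a doubling measure supporting a $p$-Poincaré inequality, $1\le p<\infty$. There exist constants $C_1,\epsilon_0>0$ such that the following holds. Suppose that $x,y\in X$, $x\ne y$, and $\mathcal B$ is a countable collection of open balls such that $\{x,y\}\cap\bigcup_{B\in\mathcal B}4B=\emptyset$ and such that for all $r\in(0,4d(x,y)]$ and $z\in\{x,y\}$ we have $$\sum_{B\in\mathcal B,\ B\cap B(z,r)\neq\emptyset}h_p(B)\ \le\ \epsilon_0\,h_p(B(z,r)).$$ Then there exists a rectifiable curve $\gamma:[0,1]\to X$ with $\gamma(0)=x$, $\gamma(1)=y$, whose image does not intersect $\bigcup_{B\in\mathcal B}B$, such that $\gamma\subset B(x,2d(x,y))$, $\ell(\gamma)\le C_1\,d(x,y)$, and for all $t\in[0,1]$ $$C_1\,d(\gamma(t),x)\ \ge\ \ell(\gamma|_{[0,t]}),\qquad C_1\,d(\gamma(t),y)\ \ge\ \ell(\gamma|_{[t,1]}).$$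
   Context: A metric measure space $(X,d,\mu)$ is a separable metric space with a Radon measure $\mu$. It is geodesic if any two points $x,y$ are joined by a rectifiable curve of length $d(x,y)$. Open balls are $B(x,r)=\{y: d(x,y)<r\}$, $r>0$; each ball carries a specified center and radius, $\mathrm{rad}(B(x,r))=r$, and $CB=B(x,Cr)$ for $B=B(x,r)$, $C>0$. For a ball $B$, $h_p(B)=\mu(B)/\mathrm{rad}(B)^p$. Doubling measure: there is $D_\mu\ge1$ with $0<\mu(B(x,2r))\le D_\mu\,\mu(B(x,r))<\infty$ for all balls. Curves are continuous maps from compact intervals; $\ell$ is length. A Borel function $g:X\to[0,\infty]$ is an upper gradient of $f$ if $|f(\gamma(0))-f(\gamma(1))|\le\int_\gamma g\,ds$ for all rectifiable curves $\gamma:[0,1]\to X$. The $p$-Poincaré inequality: there are constants $C_P,\lambda\ge 1$ such that for all $f\in L^1_{\rm loc}(X)$, all upper gradients $g$ of $f$ and all balls $B(x,r)$, $\frac1{\mu(B(x,r))}\int_{B(x,r)}|f-f_{B(x,r)}|\,d\mu\le C_P\,r\left(\frac1{\mu(B(x,\lambda r))}\int_{B(x,\lambda r)}g^p\,d\mu\right)^{1/p}$, where $f_A=\frac1{\mu(A)}\int_A f\,d\mu$. *)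

theory Defs
  imports "HOL-Analysis.Analysis"
begin

section \<open>Curves, length and line integrals\<close>

text \<open>The restriction of \<open>\<gamma>\<close> to \<open>[a, b]\<close> has length \<open>curve_length \<gamma> a b\<close>, possibly infinite.\<close>

definition curve_length :: "(real \<Rightarrow> 'a::metric_space) \<Rightarrow> real \<Rightarrow> real \<Rightarrow> ennreal" where
  "curve_length \<gamma> a b =
     (SUP (n, t) \<in> {(n :: nat, t :: nat \<Rightarrow> real). t 0 = a \<and> t n = b \<and> (\<forall>i<n. t i \<le> t (Suc i))}.
        \<Sum>i<n. ennreal (dist (\<gamma> (t i)) (\<gamma> (t (Suc i)))))"

definition rectifiable_path :: "(real \<Rightarrow> 'a::metric_space) \<Rightarrow> bool" where
  "rectifiable_path \<gamma> \<longleftrightarrow> path \<gamma> \<and> curve_length \<gamma> 0 1 < \<infinity>"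

definition geodesic :: "'a::metric_space set \<Rightarrow> bool" where
  "geodesic S \<longleftrightarrow>
     (\<forall>x\<in>S. \<forall>y\<in>S. \<exists>\<gamma>. rectifiable_path \<gamma> \<and> path_image \<gamma> \<subseteq> S \<and>
        pathstart \<gamma> = x \<and> pathfinish \<gamma> = y \<and> curve_length \<gamma> 0 1 = ennreal (dist x y))"

text \<open>The arc-length parametrization, for \<open>0 \<le> s \<le> \<ell>(\<gamma>)\<close>. If \<open>\<gamma>\<close> is rectifiable, such a \<open>t\<close>
  exists, and \<open>\<gamma>\<close> is constant on the set of all such \<open>t\<close>, so the description is proper.\<close>

definition arclength_param :: "(real \<Rightarrow> 'a::metric_space) \<Rightarrow> real \<Rightarrow> 'a" where
  "arclength_param \<gamma> s = (THE z. \<exists>t\<in>{0..1}. curve_length \<gamma> 0 t = ennreal s \<and> \<gamma> t = z)"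

text \<open>The integral of \<open>g\<close> along the rectifiable path \<open>\<gamma>\<close> with respect to arc length.\<close>

definition line_integral :: "(real \<Rightarrow> 'a::metric_space) \<Rightarrow> ('a \<Rightarrow> ennreal) \<Rightarrow> ennreal" where
  "line_integral \<gamma> g =
     (\<integral>\<^sup>+s\<in>{0..enn2real (curve_length \<gamma> 0 1)}. g (arclength_param \<gamma> s) \<partial>lborel)"

definition upper_gradient :: "('a::metric_space \<Rightarrow> ennreal) \<Rightarrow> ('a \<Rightarrow> real) \<Rightarrow> bool" where
  "upper_gradient g f \<longleftrightarrow>
     g \<in> borel_measurable borel \<and>
     (\<forall>\<gamma>. rectifiable_path \<gamma> \<longrightarrow> ennreal \<bar>f (\<gamma> 0) - f (\<gamma> 1)\<bar> \<le> line_integral \<gamma> g)"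


section \<open>Measures on metric spaces\<close>

definition radon_measure :: "'a::metric_space measure \<Rightarrow> bool" where
  "radon_measure \<mu> \<longleftrightarrow>
     sets \<mu> = sets borel \<and>
     (\<forall>K. compact K \<longrightarrow> emeasure \<mu> K < \<infinity>) \<and>
     (\<forall>A\<in>sets borel. emeasure \<mu> A = (INF U\<in>{U. open U \<and> A \<subseteq> U}. emeasure \<mu> U)) \<and>
     (\<forall>U. open U \<longrightarrow> emeasure \<mu> U = (SUP K\<in>{K. compact K \<and> K \<subseteq> U}. emeasure \<mu> K))"

definition doubling_measure :: "'a::metric_space measure \<Rightarrow> bool" where
  "doubling_measure \<mu> \<longleftrightarrow>
     (\<exists>D\<ge>1. \<forall>x. \<forall>r>0.
        0 < emeasure \<mu> (ball x (2 * r)) \<and>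
        emeasure \<mu> (ball x (2 * r)) \<le> ennreal D * emeasure \<mu> (ball x r) \<and>
        ennreal D * emeasure \<mu> (ball x r) < \<infinity>)"

text \<open>Powers of extended nonnegative numbers, for an exponent \<open>p > 0\<close>.\<close>

definition ennreal_powr :: "ennreal \<Rightarrow> real \<Rightarrow> ennreal" where
  "ennreal_powr x p = (if x = \<infinity> then \<infinity> else ennreal (enn2real x powr p))"

text \<open>The members of \<open>L\<^sup>1\<^sub>l\<^sub>o\<^sub>c\<close> are \<open>\<mu>\<close>-measurable functions, i.e. measurable with respect to
  the completion of the Borel measure \<open>\<mu>\<close>.\<close>

definition L1_loc :: "'a::metric_space measure \<Rightarrow> ('a \<Rightarrow> real) set" where
  "L1_loc \<mu> = {f. f \<in> borel_measurable (completion \<mu>) \<and>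
                   (\<forall>x. \<exists>r>0. set_integrable (completion \<mu>) (ball x r) f)}"

definition average :: "'a measure \<Rightarrow> 'a set \<Rightarrow> ('a \<Rightarrow> real) \<Rightarrow> real" where
  "average \<mu> A f = (LINT z:A|completion \<mu>. f z) / measure \<mu> A"

text \<open>Both sides are extended nonnegative numbers; the right-hand side may be infinite.\<close>

definition supports_Poincare :: "real \<Rightarrow> 'a::metric_space measure \<Rightarrow> bool" where
  "supports_Poincare p \<mu> \<longleftrightarrow>
     (\<exists>C\<ge>1. \<exists>\<Lambda>\<ge>1. \<forall>f\<in>L1_loc \<mu>. \<forall>g. upper_gradient g f \<longrightarrow> (\<forall>x. \<forall>r>0.
        (\<integral>\<^sup>+z\<in>ball x r. ennreal \<bar>f z - average \<mu> (ball x r) f\<bar> \<partial>completion \<mu>)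
            / emeasure \<mu> (ball x r)
        \<le> ennreal (C * r) *
          ennreal_powr ((\<integral>\<^sup>+z\<in>ball x (\<Lambda> * r). ennreal_powr (g z) p \<partial>\<mu>)
            / emeasure \<mu> (ball x (\<Lambda> * r))) (1 / p)))"


section \<open>Balls with specified center and radius\<close>

text \<open>A ball is a pair of center and radius, since neither is determined by the underlying set.\<close>

definition ball_set :: "'a::metric_space \<times> real \<Rightarrow> 'a set" where
  "ball_set B = ball (fst B) (snd B)"

definition scale_ball :: "real \<Rightarrow> 'a \<times> real \<Rightarrow> 'a \<times> real" where
  "scale_ball C B = (fst B, C * snd B)"

definition ball_content :: "real \<Rightarrow> 'a::metric_space measure \<Rightarrow> 'a \<times> real \<Rightarrow> ennreal" where
  "ball_content p \<mu> B = emeasure \<mu> (ball_set B) / ennreal (snd B powr p)"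

end

theory Submission
  imports Defs
begin

text \<open>By compactness of closed balls and Tychonoff's theorem it suffices to treat finite families of
  balls, with uniform constants. For these, cover a geodesic from \<open>x\<close> to its midpoint by balls
  \<open>ball (\<sigma> s) (\<delta> * s)\<close> with \<open>s\<close> growing by the factor \<open>1 + \<delta>\<close>, starting at a scale where no member
  of the family is seen. Inductively, at least three quarters of each such ball can be reached from
  \<open>x\<close> by tame curves avoiding the family. Indeed, if \<open>A\<close> is a large set in one ball and a large part
  \<open>E\<close> of the next were not reachable from \<open>A\<close> by curves of length \<open>M = K * \<delta> * s\<close>, the truncated length
  distance from \<open>A\<close>, raised to \<open>M\<close> on the balls by cutoffs, would be \<open>0\<close> on \<open>A\<close> and \<open>M\<close> on \<open>E\<close>, whereas its
  upper gradient has \<open>p\<close>-th power \<open>1\<close> plus a multiple of the sum of \<open>(M / rad B) powr p\<close> over the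
  doubled balls. For small content this contradicts the Poincare inequality. The sets reached from
  \<open>x\<close> and from \<open>y\<close> near the midpoint are both so large that they meet.\<close>

section \<open>Length of curves and arc length\<close>

text \<open>The step from one scale to the next must not lose constants, since the number of scales
  is unbounded. Measure does not decay: of the three quarters reached, at most one quarter lies in
  doubled balls, the half that remains is all the Poincare estimate needs, and that estimate returns
  three quarters afresh. Length does not pile up: a step at scale \<open>s\<close> costs at most
  \<open>reach_const\<close> times \<open>step_ratio * s\<close>, which is exactly the growth of the
  scale, so the costs telescope to \<open>reach_const * s\<close>. Each added piece also stays
  within \<open>s / 2\<close> of a centre at distance \<open>s\<close> from \<open>x\<close>; hence
  length and distance to \<open>x\<close> remain comparable along the whole curve. Finiteness of the
  family enters through the closedness of a finite union of closed balls. It gives \<open>x\<close>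
  a free neighbourhood, where the induction can start, and it gives every point off the closed balls
  a neighbourhood in which the length distance is 1-Lipschitz. No bound depends on the number of
  balls, which is what allows the passage to the full family.\<close>

lemma curve_length_partition_le:
  fixes t :: "nat \<Rightarrow> real"
  assumes "t 0 = a" "t n = b" "\<And>i. i < n \<Longrightarrow> t i \<le> t (Suc i)"
  shows "(\<Sum>i<n. ennreal (dist (\<gamma> (t i)) (\<gamma> (t (Suc i))))) \<le> curve_length \<gamma> a b"
  unfolding curve_length_def
  by (rule SUP_upper2[where i = "(n, t)"]) (use assms in auto)

lemma curve_length_leI:
  assumes "\<And>n (t :: nat \<Rightarrow> real). t 0 = a \<Longrightarrow> t n = b \<Longrightarrow> (\<And>i. i < n \<Longrightarrow> t i \<le> t (Suc i)) \<Longrightarrow>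
     (\<Sum>i<n. ennreal (dist (\<gamma> (t i)) (\<gamma> (t (Suc i))))) \<le> K"
  shows "curve_length \<gamma> a b \<le> K"
  unfolding curve_length_def by (rule SUP_least) (use assms in auto)

lemma dist_le_curve_length:
  assumes "a \<le> b"
  shows "ennreal (dist (\<gamma> a) (\<gamma> b)) \<le> curve_length \<gamma> a b"
  using curve_length_partition_le[of "\<lambda>i. if i = 0 then a else b" a 1 b \<gamma>] assms by simp

lemma partition_mono:
  fixes t :: "nat \<Rightarrow> real"
  assumes "\<And>i. i < n \<Longrightarrow> t i \<le> t (Suc i)" "i \<le> j" "j \<le> n"
  shows "t i \<le> t j"
  using assms(2,3)
proof (induction j rule: dec_induct)
  case (step k)
  then show ?case using assms(1)[of k] by simp
qed simp

lemma curve_length_superadditive: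
  assumes "a \<le> c" "c \<le> b"
  shows "curve_length \<gamma> a c + curve_length \<gamma> c b \<le> curve_length \<gamma> a b"
proof -
  let ?S = "\<lambda>n (t :: nat \<Rightarrow> real). (\<Sum>i<n. ennreal (dist (\<gamma> (t i)) (\<gamma> (t (Suc i)))))"
  let ?P = "\<lambda>a b. {(n :: nat, t :: nat \<Rightarrow> real). t 0 = a \<and> t n = b \<and> (\<forall>i<n. t i \<le> t (Suc i))}"
  \<comment> \<open>A summand can be moved into a supremum in \<open>ennreal\<close> only if the
    index set is nonempty.\<close>
  have ne: "?P a b \<noteq> {}" if "a \<le> b" for a b
  proof -
    have "(1, \<lambda>i. if i = 0 then a else b) \<in> ?P a b" using that by auto
    then show ?thesis by blast
  qed
  have "?S n t + ?S m u \<le> curve_length \<gamma> a b"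
    if "t 0 = a" "t n = c" "\<forall>i<n. t i \<le> t (Suc i)" "u 0 = c" "u m = b" "\<forall>i<m. u i \<le> u (Suc i)"
    for n t m u
  proof -
    \<comment> \<open>The node \<open>c\<close> is shared, \<open>t n = u 0\<close>, so
      \<open>w2\<close> holds at \<open>i = 0\<close> too and no interval is lost at the
      junction.\<close>
    define w where "w i = (if i \<le> n then t i else u (i - n))" for i
    have w2: "w (n + i) = u i" for i using that by (auto simp: w_def)
    have "?S (n + m) w = (\<Sum>i\<in>{..<n} \<union> (+) n ` {..<m}. ennreal (dist (\<gamma> (w i)) (\<gamma> (w (Suc i)))))"
    proof (rule sum.cong)
      show "{..<n + m} = {..<n} \<union> (+) n ` {..<m}"
        by (auto simp: image_iff) (metis add_diff_inverse_nat lessThan_iff nat_add_left_cancel_less)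
    qed auto
    also have "\<dots> = ?S n w + (\<Sum>i\<in>(+) n ` {..<m}. ennreal (dist (\<gamma> (w i)) (\<gamma> (w (Suc i)))))"
      by (rule sum.union_disjoint) auto
    also have "(\<Sum>i\<in>(+) n ` {..<m}. ennreal (dist (\<gamma> (w i)) (\<gamma> (w (Suc i))))) = ?S m u"
      using w2 by (subst sum.reindex) (auto simp: add_Suc_right[symmetric] simp del: add_Suc_right)
    also have "?S n w = ?S n t" by (rule sum.cong) (auto simp: w_def)
    finally have "?S n t + ?S m u = ?S (n + m) w" by simp
    also have "\<dots> \<le> curve_length \<gamma> a b"
    proof (rule curve_length_partition_le)
      show "w 0 = a" "w (n + m) = b" using that w2 by (auto simp: w_def)
      fix i assume "i < n + m"
      show "w i \<le> w (Suc i)"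
      proof (cases "i < n")
        case True then show ?thesis using that by (auto simp: w_def)
      next
        case False
        then obtain j where "i = n + j" using le_Suc_ex not_less by blast
        then show ?thesis using that w2[of j] w2[of "Suc j"] \<open>i < n + m\<close> by auto
      qed
    qed
    finally show ?thesis .
  qed
  then have "(SUP q\<in>?P c b. case q of (m, u) \<Rightarrow> ?S n t + ?S m u) \<le> curve_length \<gamma> a b"
    if "(n, t) \<in> ?P a c" for n t
    by (intro SUP_least) (use that in auto)
  then have "?S n t + curve_length \<gamma> c b \<le> curve_length \<gamma> a b"
    if "(n, t) \<in> ?P a c" for n t
    unfolding curve_length_def[of \<gamma> c b] using ennreal_SUP_add_right[OF ne[OF assms(2)]] that
    by (auto simp: split_def)
  then have "(SUP q\<in>?P a c. (case q of (n, t) \<Rightarrow> ?S n t) + curve_length \<gamma> c b) \<le> curve_length \<gamma> a b"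
    by (intro SUP_least) auto
  then show ?thesis
    unfolding curve_length_def[of \<gamma> a c] using ennreal_SUP_add_left[OF ne[OF assms(1)]]
    by (auto simp: split_def)
qed

text \<open>Capping a partition from above and from below at \<open>c\<close> gives partitions of
  the two pieces without locating the interval that contains \<open>c\<close>. Only that interval
  needs the triangle inequality; on any other one of the two terms vanishes.\<close>

lemma curve_length_subadditive:
  assumes "a \<le> c" "c \<le> b"
  shows "curve_length \<gamma> a b \<le> curve_length \<gamma> a c + curve_length \<gamma> c b"
proof (rule curve_length_leI)
  fix n and t :: "nat \<Rightarrow> real"
  assume t: "t 0 = a" "t n = b" "\<And>i. i < n \<Longrightarrow> t i \<le> t (Suc i)"
  have "(\<Sum>i<n. ennreal (dist (\<gamma> (t i)) (\<gamma> (t (Suc i))))) \<le>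
     (\<Sum>i<n. ennreal (dist (\<gamma> (min (t i) c)) (\<gamma> (min (t (Suc i)) c))) +
            ennreal (dist (\<gamma> (max (t i) c)) (\<gamma> (max (t (Suc i)) c))))"
  proof (rule sum_mono)
    fix i assume "i \<in> {..<n}"
    then have "t i \<le> t (Suc i)" using t by auto
    moreover have "dist (\<gamma> (t i)) (\<gamma> (t (Suc i))) \<le> dist (\<gamma> (t i)) (\<gamma> c) + dist (\<gamma> c) (\<gamma> (t (Suc i)))"
      by (rule dist_triangle)
    ultimately show "ennreal (dist (\<gamma> (t i)) (\<gamma> (t (Suc i)))) \<le>
       ennreal (dist (\<gamma> (min (t i) c)) (\<gamma> (min (t (Suc i)) c))) +
       ennreal (dist (\<gamma> (max (t i) c)) (\<gamma> (max (t (Suc i)) c)))"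
      by (cases "t i \<le> c"; cases "t (Suc i) \<le> c")
         (auto simp: min_def max_def ennreal_plus[symmetric] simp del: ennreal_plus)
  qed
  also have "\<dots> = (\<Sum>i<n. ennreal (dist (\<gamma> (min (t i) c)) (\<gamma> (min (t (Suc i)) c)))) +
     (\<Sum>i<n. ennreal (dist (\<gamma> (max (t i) c)) (\<gamma> (max (t (Suc i)) c))))"
    by (rule sum.distrib)
  also have "\<dots> \<le> curve_length \<gamma> a c + curve_length \<gamma> c b"
    by (intro add_mono curve_length_partition_le[where t = "\<lambda>i. min (t i) c"]
      curve_length_partition_le[where t = "\<lambda>i. max (t i) c"])
      (use t assms in \<open>auto simp: min_def max_def intro: order_trans\<close>)
  finally show "(\<Sum>i<n. ennreal (dist (\<gamma> (t i)) (\<gamma> (t (Suc i))))) \<le> curve_length \<gamma> a c + curve_length \<gamma> c b" .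
qed

lemma curve_length_add:
  "a \<le> c \<Longrightarrow> c \<le> b \<Longrightarrow> curve_length \<gamma> a b = curve_length \<gamma> a c + curve_length \<gamma> c b"
  by (intro antisym curve_length_subadditive curve_length_superadditive)

lemma curve_length_refl: "curve_length \<gamma> a a = 0"
proof -
  have "curve_length \<gamma> a a \<le> 0"
  proof (rule curve_length_leI)
    fix n and t :: "nat \<Rightarrow> real"
    assume t: "t 0 = a" "t n = a" "\<And>i. i < n \<Longrightarrow> t i \<le> t (Suc i)"
    have "t i = a" if "i \<le> n" for i
      using partition_mono[of n t 0 i] partition_mono[of n t i n] t that by force
    then show "(\<Sum>i<n. ennreal (dist (\<gamma> (t i)) (\<gamma> (t (Suc i))))) \<le> 0" by simp
  qed
  then show ?thesis by simp
qed

lemma curve_length_mono: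
  assumes "a \<le> a'" "a' \<le> b'" "b' \<le> b"
  shows "curve_length \<gamma> a' b' \<le> curve_length \<gamma> a b"
proof -
  have "curve_length \<gamma> a' b' \<le> curve_length \<gamma> a' b"
    using curve_length_superadditive[of a' b' b \<gamma>] assms
    by (metis add.right_neutral add_left_mono order_trans zero_le)
  also have "\<dots> \<le> curve_length \<gamma> a b"
    using curve_length_superadditive[of a a' b \<gamma>] assms
    by (metis add_increasing order_trans zero_le order_refl)
  finally show ?thesis .
qed

lemma curve_length_lipschitz:
  assumes "\<And>s t. a \<le> s \<Longrightarrow> s \<le> t \<Longrightarrow> t \<le> b \<Longrightarrow> dist (\<gamma> s) (\<gamma> t) \<le> K * (t - s)"
  shows "curve_length \<gamma> a b \<le> ennreal (K * (b - a))"
proof (rule curve_length_leI)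
  fix n and t :: "nat \<Rightarrow> real"
  assume t: "t 0 = a" "t n = b" "\<And>i. i < n \<Longrightarrow> t i \<le> t (Suc i)"
  have "dist (\<gamma> (t i)) (\<gamma> (t (Suc i))) \<le> K * (t (Suc i) - t i)" if "i < n" for i
    using partition_mono[of n t 0 i] partition_mono[of n t "Suc i" n] t that
    by (intro assms) auto
  then have "(\<Sum>i<n. dist (\<gamma> (t i)) (\<gamma> (t (Suc i)))) \<le> (\<Sum>i<n. K * (t (Suc i) - t i))"
    by (intro sum_mono) auto
  also have "\<dots> = K * (b - a)"
    using t by (simp add: sum_distrib_left[symmetric] sum_lessThan_telescope)
  finally show "(\<Sum>i<n. ennreal (dist (\<gamma> (t i)) (\<gamma> (t (Suc i))))) \<le> ennreal (K * (b - a))"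
    by (simp add: sum_ennreal ennreal_leI)
qed


text \<open>A polygonal sum whose nodes move continuously with \<open>s\<close> is continuous in
  \<open>s\<close>. Applied to partitions clamped at \<open>s\<close>, this makes the lengths of the
  initial and of the final piece lower semicontinuous.\<close>

lemma eventually_partition_sum_greater:
  assumes \<gamma>: "continuous_on {a..b} \<gamma>" 
    and c: "\<And>i. i \<le> n \<Longrightarrow> continuous_on {a..b} (c i)" "\<And>i s. i \<le> n \<Longrightarrow> s \<in> {a..b} \<Longrightarrow> c i s \<in> {a..b}"
    and s0: "s0 \<in> {a..b}"
    and k: "k < (\<Sum>i<n. ennreal (dist (\<gamma> (c i s0)) (\<gamma> (c (Suc i) s0))))"
  shows "eventually (\<lambda>s. s \<in> {a..b} \<and> k < (\<Sum>i<n. ennreal (dist (\<gamma> (c i s)) (\<gamma> (c (Suc i) s)))))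
           (at s0 within {a..b})"
proof -
  let ?f = "\<lambda>s. \<Sum>i<n. dist (\<gamma> (c i s)) (\<gamma> (c (Suc i) s))"
  obtain K where K: "k = ennreal K" "0 \<le> K" using k by (cases k) auto
  have "continuous_on {a..b} ?f"
    by (intro continuous_intros continuous_on_compose2[OF \<gamma>] c) (use c(2) in auto)
  then have "(?f \<longlongrightarrow> ?f s0) (at s0 within {a..b})"
    using s0 by (auto simp: continuous_on)
  moreover have "K < ?f s0" using k K by (simp add: sum_ennreal ennreal_less_iff)
  ultimately have "eventually (\<lambda>s. K < ?f s) (at s0 within {a..b})"
    by (auto dest: order_tendstoD)
  moreover have "eventually (\<lambda>x. x \<in> {a..b}) (at s0 within {a..b})"
    by (auto simp: eventually_at_filter)
  ultimately show ?thesis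
    by eventually_elim (use K in \<open>simp add: sum_ennreal ennreal_less_iff\<close>)
qed

lemma eventually_curve_length_left_greater:
  assumes \<gamma>: "continuous_on {a..b} \<gamma>" and s0: "s0 \<in> {a..b}" and k: "k < curve_length \<gamma> a s0"
  shows "eventually (\<lambda>s. k < curve_length \<gamma> a s) (at s0 within {a..b})"
proof -
  obtain n and t :: "nat \<Rightarrow> real" where t: "t 0 = a" "t n = s0" "\<And>i. i < n \<Longrightarrow> t i \<le> t (Suc i)"
    and kt: "k < (\<Sum>i<n. ennreal (dist (\<gamma> (t i)) (\<gamma> (t (Suc i)))))"
    using k unfolding curve_length_def less_SUP_iff by auto
  have ti: "a \<le> t i \<and> t i \<le> s0" if "i \<le> n" for i
    using partition_mono[of n t 0 i] partition_mono[of n t i n] t that by auto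
  have "(\<Sum>i<n. ennreal (dist (\<gamma> (min (t i) s0)) (\<gamma> (min (t (Suc i)) s0)))) =
      (\<Sum>i<n. ennreal (dist (\<gamma> (t i)) (\<gamma> (t (Suc i)))))"
    by (rule sum.cong) (use ti in \<open>auto simp: min_absorb1\<close>)
  then have "eventually (\<lambda>s. s \<in> {a..b} \<and> k < (\<Sum>i<n. ennreal (dist (\<gamma> (min (t i) s)) (\<gamma> (min (t (Suc i)) s)))))
           (at s0 within {a..b})"
    by (intro eventually_partition_sum_greater \<gamma> s0 continuous_intros)
       (use ti s0 kt in \<open>auto simp: min_def intro: order_trans\<close>)
  then show ?thesis
  proof (rule eventually_mono, elim conjE)
    fix s assume s: "s \<in> {a..b}"
      and "k < (\<Sum>i<n. ennreal (dist (\<gamma> (min (t i) s)) (\<gamma> (min (t (Suc i)) s))))" (is "_ < ?S")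
    note this(2)
    also have "?S \<le> curve_length \<gamma> a (min s0 s)"
      by (rule curve_length_partition_le[where t = "\<lambda>i. min (t i) s"])
         (use t s in \<open>auto simp: min_def intro: order_trans\<close>)
    also have "\<dots> \<le> curve_length \<gamma> a s"
      by (rule curve_length_mono) (use s s0 in auto)
    finally show "k < curve_length \<gamma> a s" .
  qed
qed

lemma eventually_curve_length_right_greater:
  assumes \<gamma>: "continuous_on {a..b} \<gamma>" and s0: "s0 \<in> {a..b}" and k: "k < curve_length \<gamma> s0 b"
  shows "eventually (\<lambda>s. k < curve_length \<gamma> s b) (at s0 within {a..b})"
proof -
  obtain n and t :: "nat \<Rightarrow> real" where t: "t 0 = s0" "t n = b" "\<And>i. i < n \<Longrightarrow> t i \<le> t (Suc i)"
    and kt: "k < (\<Sum>i<n. ennreal (dist (\<gamma> (t i)) (\<gamma> (t (Suc i)))))"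
    using k unfolding curve_length_def less_SUP_iff by auto
  have ti: "s0 \<le> t i \<and> t i \<le> b" if "i \<le> n" for i
    using partition_mono[of n t 0 i] partition_mono[of n t i n] t that by auto
  have "(\<Sum>i<n. ennreal (dist (\<gamma> (max (t i) s0)) (\<gamma> (max (t (Suc i)) s0)))) =
      (\<Sum>i<n. ennreal (dist (\<gamma> (t i)) (\<gamma> (t (Suc i)))))"
    by (rule sum.cong) (use ti in \<open>auto simp: max_absorb1\<close>)
  then have "eventually (\<lambda>s. s \<in> {a..b} \<and> k < (\<Sum>i<n. ennreal (dist (\<gamma> (max (t i) s)) (\<gamma> (max (t (Suc i)) s)))))
           (at s0 within {a..b})"
    by (intro eventually_partition_sum_greater \<gamma> s0 continuous_intros)
       (use ti s0 kt in \<open>auto simp: max_def intro: order_trans\<close>)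
  then show ?thesis
  proof (rule eventually_mono, elim conjE)
    fix s assume s: "s \<in> {a..b}"
      and "k < (\<Sum>i<n. ennreal (dist (\<gamma> (max (t i) s)) (\<gamma> (max (t (Suc i)) s))))" (is "_ < ?S")
    note this(2)
    also have "?S \<le> curve_length \<gamma> (max s0 s) b"
      by (rule curve_length_partition_le[where t = "\<lambda>i. max (t i) s"])
         (use t s in \<open>auto simp: max_def intro: order_trans\<close>)
    also have "\<dots> \<le> curve_length \<gamma> s b"
      by (rule curve_length_mono) (use s s0 in auto)
    finally show "k < curve_length \<gamma> s b" .
  qed
qed

text \<open>The lengths of the initial and the final piece are both lower semicontinuous and have a
  constant finite sum, so each of them is upper semicontinuous as well.\<close>

lemma continuous_on_curve_length:
  assumes \<gamma>: "continuous_on {a..b} \<gamma>" and fin: "curve_length \<gamma> a b < \<infinity>"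
  shows "continuous_on {a..b} (\<lambda>t. enn2real (curve_length \<gamma> a t))"
  unfolding continuous_on
proof (intro ballI order_tendstoI)
  fix s0 assume s0: "s0 \<in> {a..b}"
  have fin1: "curve_length \<gamma> a s < \<infinity>" "curve_length \<gamma> s b < \<infinity>" if "s \<in> {a..b}" for s
    using curve_length_mono[of a a s b \<gamma>] curve_length_mono[of a s b b \<gamma>] that fin
    by (auto intro: le_less_trans)
  define w where "w s = enn2real (curve_length \<gamma> s b)" for s
  define v where "v s = enn2real (curve_length \<gamma> a s)" for s
  have v: "curve_length \<gamma> a s = ennreal (v s)" and w: "curve_length \<gamma> s b = ennreal (w s)" 
    if "s \<in> {a..b}" for s
    using fin1[OF that] by (auto simp: v_def w_def)
  have nn: "0 \<le> v s" "0 \<le> w s" for s by (auto simp: v_def w_def)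
  have vw: "v s + w s = v b" if "s \<in> {a..b}" for s
  proof -
    have "ennreal (v b) = ennreal (v s + w s)"
      using curve_length_add[of a s b \<gamma>] that v[of b] v[OF that] w[OF that] nn by simp
    then show ?thesis using nn by (metis add_nonneg_nonneg ennreal_inj)
  qed
  have ev: "eventually (\<lambda>x. x \<in> {a..b}) (at s0 within {a..b})"
    by (auto simp: eventually_at_filter)
  fix k
  show "eventually (\<lambda>s. k < enn2real (curve_length \<gamma> a s)) (at s0 within {a..b})"
    if k: "k < enn2real (curve_length \<gamma> a s0)"
  proof (cases "0 \<le> k")
    case True
    then have "ennreal k < curve_length \<gamma> a s0"
      using k v[OF s0] nn by (simp add: ennreal_less_iff v_def[symmetric])
    from eventually_curve_length_left_greater[OF \<gamma> s0 this] ev show ?thesis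
      by eventually_elim (use v True in \<open>auto simp: ennreal_less_iff v_def[symmetric]\<close>)
  next
    case False
    then have "k < enn2real (curve_length \<gamma> a s)" for s
      using enn2real_nonneg[of "curve_length \<gamma> a s"] by linarith
    then show ?thesis by simp
  qed
  show "eventually (\<lambda>s. enn2real (curve_length \<gamma> a s) < k) (at s0 within {a..b})"
    if k: "enn2real (curve_length \<gamma> a s0) < k"
  proof (cases "0 \<le> v b - k")
    case True
    then have "ennreal (v b - k) < curve_length \<gamma> s0 b"
      using k v[OF s0] nn vw[OF s0] w[OF s0] by (simp add: ennreal_less_iff v_def[symmetric])
    from eventually_curve_length_right_greater[OF \<gamma> s0 this] ev show ?thesis
    proof eventually_elim
      case (elim s)
      then show ?case using vw[of s] w[of s] True by (simp add: ennreal_less_iff v_def[symmetric])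
    qed
  next
    case False
    from ev show ?thesis
    proof eventually_elim
      case (elim s)
      then show ?case using False vw[of s] nn(2)[of s] by (simp add: v_def[symmetric])
    qed
  qed
qed

section \<open>The arc-length parametrization\<close>

lemma rectifiable_path_arclength_param:
  assumes \<gamma>: "rectifiable_path \<gamma>" and s: "0 \<le> s" "s \<le> enn2real (curve_length \<gamma> 0 1)"
  obtains t where "t \<in> {0..1}" "curve_length \<gamma> 0 t = ennreal s" "arclength_param \<gamma> s = \<gamma> t"
proof -
  have c: "continuous_on {0..1} \<gamma>" and fin: "curve_length \<gamma> 0 1 < \<infinity>"
    using \<gamma> by (auto simp: rectifiable_path_def path_def)
  have fin1: "curve_length \<gamma> 0 t < \<infinity>" if "t \<in> {0..1}" for t
    using curve_length_mono[of 0 0 t 1 \<gamma>] that fin by (auto intro: le_less_trans)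
  obtain t where t: "t \<in> {0..1}" "enn2real (curve_length \<gamma> 0 t) = s"
    using IVT'[OF _ _ _ continuous_on_curve_length[OF c fin], of s] s
    by (auto simp: curve_length_refl)
  then have ts: "curve_length \<gamma> 0 t = ennreal s" using fin1[of t] by auto
  \<comment> \<open>Equal finite initial lengths can be cancelled: the piece between has length
    zero, hence equal endpoints.\<close>
  have uniq: "\<gamma> a = \<gamma> b" if "a \<in> {0..1}" "a \<le> b" "curve_length \<gamma> 0 a = ennreal s" "curve_length \<gamma> 0 b = ennreal s" for a b
  proof -
    have "ennreal s = ennreal s + curve_length \<gamma> a b"
      using curve_length_add[of 0 a b \<gamma>] that by auto
    then have "curve_length \<gamma> a b = 0"
      by (metis add.right_neutral ennreal_add_left_cancel ennreal_neq_top infinity_ennreal_def)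
    then show ?thesis using dist_le_curve_length[OF that(2), of \<gamma>] by simp
  qed
  have "arclength_param \<gamma> s = \<gamma> t"
    unfolding arclength_param_def
  proof (rule the_equality)
    show "\<exists>t'\<in>{0..1}. curve_length \<gamma> 0 t' = ennreal s \<and> \<gamma> t' = \<gamma> t" using t ts by auto
    fix z assume "\<exists>t'\<in>{0..1}. curve_length \<gamma> 0 t' = ennreal s \<and> \<gamma> t' = z"
    then show "z = \<gamma> t" using uniq t ts by (metis linear)
  qed
  then show ?thesis using that t ts by blast
qed

lemma arclength_param_lipschitz:
  assumes \<gamma>: "rectifiable_path \<gamma>"
  shows "1-lipschitz_on {0..enn2real (curve_length \<gamma> 0 1)} (arclength_param \<gamma>)"
proof (rule lipschitz_onI)
  have *: "dist (arclength_param \<gamma> s) (arclength_param \<gamma> s') \<le> s' - s"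
    if ss: "0 \<le> s" "s < s'" "s' \<le> enn2real (curve_length \<gamma> 0 1)" for s s'
  proof -
    obtain t where t: "t \<in> {0..1}" "curve_length \<gamma> 0 t = ennreal s" "arclength_param \<gamma> s = \<gamma> t"
      using rectifiable_path_arclength_param[OF \<gamma>, of s] ss by auto
    obtain t' where t': "t' \<in> {0..1}" "curve_length \<gamma> 0 t' = ennreal s'" "arclength_param \<gamma> s' = \<gamma> t'"
      using rectifiable_path_arclength_param[OF \<gamma>, of s'] ss by auto
    have "t \<le> t'"
    proof (rule ccontr)
      assume "\<not> t \<le> t'"
      then have "ennreal s' \<le> ennreal s" using curve_length_mono[of 0 0 t' t \<gamma>] t t' by auto
      then show False using that by (simp add: ennreal_le_iff)
    qed
    have "ennreal (s + dist (\<gamma> t) (\<gamma> t')) \<le> curve_length \<gamma> 0 t + curve_length \<gamma> t t'"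
      using dist_le_curve_length[OF \<open>t \<le> t'\<close>, of \<gamma>] t that by (simp add: add_mono)
    also have "\<dots> = ennreal s'" using curve_length_add[of 0 t t' \<gamma>] \<open>t \<le> t'\<close> t t' by simp
    finally show ?thesis using t t' ss by (simp add: ennreal_le_iff del: ennreal_plus)
  qed
  fix s s' assume "s \<in> {0..enn2real (curve_length \<gamma> 0 1)}" "s' \<in> {0..enn2real (curve_length \<gamma> 0 1)}"
  then show "dist (arclength_param \<gamma> s) (arclength_param \<gamma> s') \<le> 1 * dist s s'"
    using *[of s s'] *[of s' s] by (cases s s' rule: linorder_cases) (auto simp: dist_real_def dist_commute)
qed simp

lemma arclength_param_endpoints:
  assumes \<gamma>: "rectifiable_path \<gamma>"
  shows "arclength_param \<gamma> 0 = \<gamma> 0" "arclength_param \<gamma> (enn2real (curve_length \<gamma> 0 1)) = \<gamma> 1"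
proof -
  obtain t where t: "t \<in> {0..1}" "curve_length \<gamma> 0 t = ennreal 0" "arclength_param \<gamma> 0 = \<gamma> t"
    using rectifiable_path_arclength_param[OF \<gamma>, of 0] by auto
  then show "arclength_param \<gamma> 0 = \<gamma> 0" using dist_le_curve_length[of 0 t \<gamma>] by auto
  obtain t where t: "t \<in> {0..1}" "curve_length \<gamma> 0 t = ennreal (enn2real (curve_length \<gamma> 0 1))"
    "arclength_param \<gamma> (enn2real (curve_length \<gamma> 0 1)) = \<gamma> t"
    using rectifiable_path_arclength_param[OF \<gamma>, of "enn2real (curve_length \<gamma> 0 1)"] by auto
  have "curve_length \<gamma> 0 1 < \<infinity>" using \<gamma> by (auto simp: rectifiable_path_def)
  then have "curve_length \<gamma> 0 t = curve_length \<gamma> 0 1" using t(2) by simp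
  then have "curve_length \<gamma> 0 1 + 0 = curve_length \<gamma> 0 1 + curve_length \<gamma> t 1"
    using curve_length_add[of 0 t 1 \<gamma>] t(1) by (metis add.right_neutral atLeastAtMost_iff)
  then have "curve_length \<gamma> t 1 = 0"
    using \<open>curve_length \<gamma> 0 1 < \<infinity>\<close> by (simp only: ennreal_add_left_cancel) auto
  then show "arclength_param \<gamma> (enn2real (curve_length \<gamma> 0 1)) = \<gamma> 1"
    using dist_le_curve_length[of t 1 \<gamma>] t by auto
qed

text \<open>A 1-Lipschitz map on an interval as long as the distance of its end values cannot
  shorten any part: by the triangle inequality the other two parts could not make up for it.\<close>

lemma geodesic_isometric_path:
  fixes x y :: "'a::metric_space"
  assumes "geodesic (UNIV :: 'a set)"
  obtains \<sigma> where "\<sigma> 0 = x" "\<sigma> (dist x y) = y"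
    "\<And>s t. s \<in> {0..dist x y} \<Longrightarrow> t \<in> {0..dist x y} \<Longrightarrow> dist (\<sigma> s) (\<sigma> t) = \<bar>s - t\<bar>"
proof -
  obtain \<gamma> where \<gamma>: "rectifiable_path \<gamma>" "\<gamma> 0 = x" "\<gamma> 1 = y" "curve_length \<gamma> 0 1 = ennreal (dist x y)"
    using assms unfolding geodesic_def pathstart_def pathfinish_def by blast
  let ?\<sigma> = "arclength_param \<gamma>"
  have L: "enn2real (curve_length \<gamma> 0 1) = dist x y" using \<gamma> by simp
  have ends: "?\<sigma> 0 = x" "?\<sigma> (dist x y) = y"
    using arclength_param_endpoints[OF \<gamma>(1)] \<gamma> L by auto
  have lip: "dist (?\<sigma> s) (?\<sigma> t) \<le> \<bar>s - t\<bar>" if "s \<in> {0..dist x y}" "t \<in> {0..dist x y}" for s t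
    using lipschitz_onD[OF arclength_param_lipschitz[OF \<gamma>(1)], unfolded L, OF that]
    by (simp add: dist_real_def)
  have ge: "t - s \<le> dist (?\<sigma> s) (?\<sigma> t)" if "0 \<le> s" "s \<le> t" "t \<le> dist x y" for s t
  proof -
    have "dist x y \<le> dist x (?\<sigma> s) + dist (?\<sigma> s) (?\<sigma> t) + dist (?\<sigma> t) y"
      by (meson add_mono dist_triangle order_refl order_trans)
    then show ?thesis using lip[of 0 s] lip[of t "dist x y"] that ends by auto
  qed
  have "dist (?\<sigma> s) (?\<sigma> t) = \<bar>s - t\<bar>" if "s \<in> {0..dist x y}" "t \<in> {0..dist x y}" for s t
    using lip[OF that] ge[of s t] ge[of t s] that by (cases "s \<le> t") (auto simp: dist_commute)
  then show ?thesis using that ends by blast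
qed

section \<open>Pointwise Lipschitz constants as upper gradients\<close>

text \<open>Compare \<open>h\<close> with the Riemann sums of \<open>u\<close>: the hypothesis is a gauge in the sense of Henstock
  and Kurzweil, so no differentiability of \<open>h\<close> is needed.\<close>

lemma abs_diff_le_integral:
  fixes h u :: "real \<Rightarrow> real"
  assumes L: "0 \<le> L" and u: "(u has_integral I) {0..L}"
    and h: "\<And>s. s \<in> {0..L} \<Longrightarrow> \<forall>\<^sub>F s' in nhds s. s' \<in> {0..L} \<longrightarrow> \<bar>h s' - h s\<bar> \<le> u s * \<bar>s' - s\<bar>"
  shows "\<bar>h L - h 0\<bar> \<le> I"
proof (rule field_le_epsilon)
  fix e :: real assume "0 < e"
  from u[unfolded has_integral_real, rule_format, OF \<open>0 < e\<close>] obtain d1 where d1: "gauge d1"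
    "\<And>D. D tagged_division_of {0..L} \<Longrightarrow> d1 fine D \<Longrightarrow> norm ((\<Sum>(x,k)\<in>D. measure lborel k *\<^sub>R u x) - I) < e"
    by metis
  have "\<exists>S. open S \<and> s \<in> S \<and> (\<forall>s'\<in>S \<inter> {0..L}. \<bar>h s' - h s\<bar> \<le> u s * \<bar>s' - s\<bar>)" if "s \<in> {0..L}" for s
    using h[OF that] unfolding eventually_nhds by auto
  then obtain d2 where d2: "\<And>s. s \<in> {0..L} \<Longrightarrow> open (d2 s) \<and> s \<in> d2 s \<and> (\<forall>s'\<in>d2 s \<inter> {0..L}. \<bar>h s' - h s\<bar> \<le> u s * \<bar>s' - s\<bar>)"
    by metis
  \<comment> \<open>A gauge has to assign a neighbourhood to every real number, whereas the
    hypothesis speaks only about \<open>{0..L}\<close>.\<close>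
  define d3 where "d3 s = (if s \<in> {0..L} then d2 s else UNIV)" for s
  have "gauge d3" using d2 by (auto simp: gauge_def d3_def)
  then obtain p where p: "p tagged_division_of {0..L}" "(\<lambda>x. d1 x \<inter> d3 x) fine p"
    using fine_division_exists_real[OF gauge_Int[OF d1(1)]] by blast
  have f: "d1 fine p" "d3 fine p" using p(2) by (auto simp: fine_def)
  \<comment> \<open>The tag lies in its interval, so both endpoints can be compared with it and the
    two parts add up to the full width.\<close>
  have *: "\<bar>h (Sup k) - h (Inf k)\<bar> \<le> measure lborel k * u x" if xk: "(x, k) \<in> p" for x k
  proof -
    obtain a b where k: "k = {a..b}" using tagged_division_ofD(4)[OF p(1) xk] by auto
    have x: "x \<in> k" "k \<subseteq> {0..L}" "k \<subseteq> d3 x" 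
      using tagged_division_ofD(2,3)[OF p(1) xk] f(2) xk by (auto simp: fine_def)
    then have ab: "a \<le> x" "x \<le> b" "x \<in> {0..L}" "a \<in> d2 x \<inter> {0..L}" "b \<in> d2 x \<inter> {0..L}"
      using k by (auto simp: d3_def subset_eq split: if_splits)
    then have "\<bar>h a - h x\<bar> \<le> u x * \<bar>a - x\<bar>" "\<bar>h b - h x\<bar> \<le> u x * \<bar>b - x\<bar>"
      using d2[of x] by blast+
    then have "\<bar>h a - h x\<bar> \<le> u x * (x - a)" "\<bar>h b - h x\<bar> \<le> u x * (b - x)"
      using ab by simp_all
    then have "\<bar>h b - h a\<bar> \<le> u x * (x - a) + u x * (b - x)" by linarith
    then show ?thesis using ab k by (simp add: algebra_simps)
  qed
  have "h L - h 0 = (\<Sum>(x,k)\<in>p. h (Sup k) - h (Inf k))"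
    using additive_tagged_division_1[OF L p(1), of h] by simp
  also have "\<bar>\<dots>\<bar> \<le> (\<Sum>(x,k)\<in>p. \<bar>h (Sup k) - h (Inf k)\<bar>)"
    unfolding split_def by (rule sum_abs)
  also have "(\<Sum>(x,k)\<in>p. \<bar>h (Sup k) - h (Inf k)\<bar>) \<le> (\<Sum>(x,k)\<in>p. measure lborel k *\<^sub>R u x)"
    by (rule sum_mono) (use * in auto)
  also have "\<dots> \<le> I + e" using d1(2)[OF p(1) f(1)] by simp
  finally show "\<bar>h L - h 0\<bar> \<le> I + e" .
qed

text \<open>Here \<open>k\<close> is any admissible slope rather than the optimal limsup of
  difference quotients, so slopes can be raised to a common value before a maximum is taken.\<close>

definition lip_at :: "('a::metric_space \<Rightarrow> real) \<Rightarrow> real \<Rightarrow> 'a \<Rightarrow> bool" where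
  "lip_at F k z \<longleftrightarrow> 0 \<le> k \<and> (\<forall>\<^sub>F w in nhds z. \<bar>F w - F z\<bar> \<le> k * dist w z)"

lemma lip_at_mono: "lip_at F k z \<Longrightarrow> k \<le> k' \<Longrightarrow> lip_at F k' z"
  unfolding lip_at_def
  by (auto elim!: eventually_mono) (meson mult_right_mono order_trans zero_le_dist)

lemma lip_at_max:
  assumes "lip_at F k z" "lip_at G k z"
  shows "lip_at (\<lambda>w. max (F w) (G w)) k z"
proof -
  have "\<forall>\<^sub>F w in nhds z. \<bar>F w - F z\<bar> \<le> k * dist w z" "\<forall>\<^sub>F w in nhds z. \<bar>G w - G z\<bar> \<le> k * dist w z"
    using assms by (auto simp: lip_at_def)
  then have "\<forall>\<^sub>F w in nhds z. \<bar>max (F w) (G w) - max (F z) (G z)\<bar> \<le> k * dist w z"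
    by eventually_elim linarith
  then show ?thesis using assms by (simp add: lip_at_def)
qed

lemma lip_at_continuous:
  assumes "\<And>z. lip_at F (g z) z"
  shows "continuous_on UNIV F"
  unfolding continuous_on
proof
  fix z
  have "((\<lambda>w. g z * dist w z) \<longlongrightarrow> g z * dist z z) (at z)"
    by (intro tendsto_intros)
  then have lim: "((\<lambda>w. g z * dist w z) \<longlongrightarrow> 0) (at z)" by simp
  have "\<forall>\<^sub>F w in nhds z. \<bar>F w - F z\<bar> \<le> g z * dist w z"
    using assms by (simp add: lip_at_def)
  then have "\<forall>\<^sub>F w in at z. norm (F w - F z) \<le> g z * dist w z"
    unfolding eventually_at_filter by (rule eventually_mono) simp
  then have "((\<lambda>w. F w - F z) \<longlongrightarrow> 0) (at z)"
    by (rule Lim_null_comparison) (rule lim)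
  then show "(F \<longlongrightarrow> F z) (at z)" by (simp add: LIM_zero_iff)
qed

text \<open>Arc length is a 1-Lipschitz parameter, so along the curve \<open>F\<close> has slope at
  most \<open>g\<close> at every single parameter. This everywhere bound is the hypothesis of
  \<open>abs_diff_le_integral\<close>.\<close>

lemma lip_at_upper_gradient:
  fixes F :: "'a::metric_space \<Rightarrow> real" and g :: "'a \<Rightarrow> real"
  assumes F: "\<And>z. lip_at F (g z) z" and g: "g \<in> borel_measurable borel" and bdd: "\<And>z. g z \<le> K"
  shows "upper_gradient (\<lambda>z. ennreal (g z)) F"
  unfolding upper_gradient_def
proof (intro conjI allI impI)
  show "(\<lambda>z. ennreal (g z)) \<in> borel_measurable borel" using g by measurable
  fix \<gamma> :: "real \<Rightarrow> 'a" assume \<gamma>: "rectifiable_path \<gamma>"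
  define L where "L = enn2real (curve_length \<gamma> 0 1)"
  let ?\<alpha> = "arclength_param \<gamma>"
  have lip: "1-lipschitz_on {0..L} ?\<alpha>"
    using arclength_param_lipschitz[OF \<gamma>] by (simp add: L_def)
  have L: "0 \<le> L" by (simp add: L_def)
  have g0: "0 \<le> g z" for z using F[of z] by (simp add: lip_at_def)
  \<comment> \<open>Clamping the parameter makes the inner function continuous on the whole line,
    from which Borel measurability of \<open>u\<close> follows.\<close>
  define u where "u s = indicator {0..L} s * g (?\<alpha> (max 0 (min L s)))" for s
  have u0: "0 \<le> u s" for s using g0 by (auto simp: u_def indicator_def)
  have c: "continuous_on UNIV (\<lambda>s. ?\<alpha> (max 0 (min L s)))"
    by (rule continuous_on_compose2[OF lipschitz_on_continuous_on[OF lip]])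
       (use L in \<open>auto intro!: continuous_intros\<close>)
  have um: "u \<in> borel_measurable borel"
    unfolding u_def using borel_measurable_continuous_onI[OF c] g
    by (auto intro!: borel_measurable_times borel_measurable_indicator)
  have nn: "(\<integral>\<^sup>+s\<in>{0..L}. ennreal (g (?\<alpha> s)) \<partial>lborel) = (\<integral>\<^sup>+s. ennreal (u s) \<partial>lborel)"
    by (rule nn_integral_cong) (auto simp: u_def indicator_def)
  \<comment> \<open>Boundedness of \<open>g\<close> makes the integral finite, as the passage to the
    gauge integral requires.\<close>
  have "(\<integral>\<^sup>+s. ennreal (u s) \<partial>lborel) \<le> (\<integral>\<^sup>+s. ennreal K * indicator {0..L} s \<partial>lborel)"
    by (rule nn_integral_mono) (auto simp: u_def indicator_def bdd ennreal_leI)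
  also have "\<dots> < \<infinity>" using L by (simp add: nn_integral_cmult_indicator ennreal_mult_less_top)
  finally obtain I where I: "(\<integral>\<^sup>+s. ennreal (u s) \<partial>lborel) = ennreal I" "0 \<le> I"
    by (cases "\<integral>\<^sup>+s. ennreal (u s) \<partial>lborel") auto
  have "(u has_integral I) UNIV"
    by (rule nn_integral_has_integral) (use um u0 I in auto)
  then have "((\<lambda>x. if x \<in> {0..L} then u x else 0) has_integral I) UNIV"
    by (rule has_integral_eq[rotated]) (auto simp: u_def)
  then have hu: "(u has_integral I) {0..L}" by (simp only: has_integral_restrict_UNIV)
  have "\<bar>F (?\<alpha> L) - F (?\<alpha> 0)\<bar> \<le> I"
  proof (rule abs_diff_le_integral[OF L hu])
    fix s assume s: "s \<in> {0..L}"
    then have us: "u s = g (?\<alpha> s)" by (auto simp: u_def)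
    obtain S where S: "open S" "?\<alpha> s \<in> S" "\<forall>w\<in>S. \<bar>F w - F (?\<alpha> s)\<bar> \<le> g (?\<alpha> s) * dist w (?\<alpha> s)"
      using F[of "?\<alpha> s"] unfolding lip_at_def eventually_nhds by blast
    then obtain e where e: "0 < e" "ball (?\<alpha> s) e \<subseteq> S" by (meson openE)
    have "\<bar>F (?\<alpha> s') - F (?\<alpha> s)\<bar> \<le> u s * \<bar>s' - s\<bar>" if "s' \<in> {0..L}" "dist s' s < e" for s'
    proof -
      have d: "dist (?\<alpha> s') (?\<alpha> s) \<le> \<bar>s' - s\<bar>"
        using lipschitz_onD[OF lip that(1) s] by (simp add: dist_real_def)
      then have "?\<alpha> s' \<in> S" using that e by (auto simp: dist_real_def dist_commute subset_eq)
      then have "\<bar>F (?\<alpha> s') - F (?\<alpha> s)\<bar> \<le> g (?\<alpha> s) * dist (?\<alpha> s') (?\<alpha> s)" using S by auto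
      also have "\<dots> \<le> u s * \<bar>s' - s\<bar>" using d g0 us by (simp add: mult_left_mono)
      finally show ?thesis .
    qed
    then show "\<forall>\<^sub>F s' in nhds s. s' \<in> {0..L} \<longrightarrow> \<bar>F (?\<alpha> s') - F (?\<alpha> s)\<bar> \<le> u s * \<bar>s' - s\<bar>"
      using e(1) unfolding eventually_nhds_metric by auto
  qed
  then have "\<bar>F (\<gamma> 0) - F (\<gamma> 1)\<bar> \<le> I"
    using arclength_param_endpoints[OF \<gamma>] by (simp add: L_def abs_minus_commute)
  then show "ennreal \<bar>F (\<gamma> 0) - F (\<gamma> 1)\<bar> \<le> line_integral \<gamma> (\<lambda>z. ennreal (g z))"
    using I nn unfolding line_integral_def L_def[symmetric] by (simp add: ennreal_leI)
qed

section \<open>Length distance avoiding a family of balls\<close>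

text \<open>The number \<open>L\<close> bounds the length because the parametrization is
  1-Lipschitz. With this encoding concatenation simply adds the bounds, and no length has to be
  computed.\<close>

definition lip_arc :: "'a::metric_space set \<Rightarrow> 'a set \<Rightarrow> 'a \<Rightarrow> real \<Rightarrow> bool" where
  "lip_arc U A v L \<longleftrightarrow> 0 \<le> L \<and>
     (\<exists>\<gamma>. 1-lipschitz_on {0..L} \<gamma> \<and> \<gamma> 0 \<in> A \<and> \<gamma> L = v \<and> \<gamma> ` {0..L} \<inter> U = {})"

lemma lipschitz_on_append:
  fixes \<gamma> \<sigma> :: "real \<Rightarrow> 'a::metric_space"
  assumes \<gamma>: "1-lipschitz_on {0..L} \<gamma>" "0 \<le> L" and \<sigma>: "1-lipschitz_on {0..L'} \<sigma>" "0 \<le> L'"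
    and eq: "\<gamma> L = \<sigma> 0"
  shows "1-lipschitz_on {0..L + L'} (\<lambda>s. if s \<le> L then \<gamma> s else \<sigma> (s - L))"
proof (rule lipschitz_on_concat[OF \<gamma>(1)])
  show "1-lipschitz_on {L..L + L'} (\<lambda>s. \<sigma> (s - L))"
  proof (rule lipschitz_onI)
    fix s t assume "s \<in> {L..L + L'}" "t \<in> {L..L + L'}"
    then show "dist (\<sigma> (s - L)) (\<sigma> (t - L)) \<le> 1 * dist s t"
      using lipschitz_onD[OF \<sigma>(1), of "s - L" "t - L"] by (auto simp: dist_real_def)
  qed simp
qed (use eq in auto)

text \<open>A geodesic from \<open>v\<close> to \<open>w\<close> stays within
  \<open>dist v w\<close> of either endpoint. The free ball may sit at the old or at the new
  endpoint, so that one fixed centre serves for both directions of a Lipschitz estimate.\<close>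

lemma lip_arc_extend:
  fixes A :: "'a::metric_space set"
  assumes geo: "geodesic (UNIV :: 'a set)" and arc: "lip_arc U A v L"
    and c: "c = v \<or> c = w" "dist v w < \<rho>" "ball c \<rho> \<inter> U = {}"
  shows "lip_arc U A w (L + dist v w)"
proof -
  obtain \<gamma> where \<gamma>: "0 \<le> L" "1-lipschitz_on {0..L} \<gamma>" "\<gamma> 0 \<in> A" "\<gamma> L = v" "\<gamma> ` {0..L} \<inter> U = {}"
    using arc by (auto simp: lip_arc_def)
  obtain \<sigma> where \<sigma>: "\<sigma> 0 = v" "\<sigma> (dist v w) = w"
    "\<And>s t. s \<in> {0..dist v w} \<Longrightarrow> t \<in> {0..dist v w} \<Longrightarrow> dist (\<sigma> s) (\<sigma> t) = \<bar>s - t\<bar>"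
    using geodesic_isometric_path[OF geo] by blast
  have "1-lipschitz_on {0..dist v w} \<sigma>"
    by (rule lipschitz_onI) (use \<sigma> in \<open>auto simp: dist_real_def\<close>)
  then have l: "1-lipschitz_on {0..L + dist v w} (\<lambda>s. if s \<le> L then \<gamma> s else \<sigma> (s - L))"
    by (intro lipschitz_on_append) (use \<gamma> \<sigma> in auto)
  have "\<sigma> s \<notin> U" if "s \<in> {0..dist v w}" for s
  proof -
    have "dist v (\<sigma> s) = s" "dist w (\<sigma> s) = dist v w - s"
      using \<sigma>(3)[of 0 s] \<sigma>(3)[of "dist v w" s] that \<sigma>(1,2) by auto
    then have "\<sigma> s \<in> ball c \<rho>" using that c(1,2) by auto
    then show ?thesis using c(3) by blast
  qed
  moreover have "\<gamma> s \<notin> U" if "s \<in> {0..L}" for s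
    using \<gamma>(5) that by blast
  ultimately have "(\<lambda>s. if s \<le> L then \<gamma> s else \<sigma> (s - L)) ` {0..L + dist v w} \<inter> U = {}"
    by auto
  then show ?thesis
    unfolding lip_arc_def using l \<gamma> \<sigma> by (intro conjI exI[of _ "\<lambda>s. if s \<le> L then \<gamma> s else \<sigma> (s - L)"]) auto
qed

text \<open>Inserting \<open>M\<close> gives unreachable points the value \<open>M\<close> and keeps
  the infimum over a nonempty set; a value below \<open>M\<close> then certifies an arc.\<close>

definition arc_dist :: "'a::metric_space set \<Rightarrow> 'a set \<Rightarrow> real \<Rightarrow> 'a \<Rightarrow> real" where
  "arc_dist U A M v = Inf (insert M {L. L \<le> M \<and> lip_arc U A v L})"

lemma arc_dist_bounds:
  assumes "0 \<le> M"
  shows "0 \<le> arc_dist U A M v" "arc_dist U A M v \<le> M"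
    and "lip_arc U A v L \<Longrightarrow> arc_dist U A M v \<le> L"
proof -
  have bdd: "bdd_below (insert M {L. L \<le> M \<and> lip_arc U A v L})"
    using assms by (intro bdd_belowI[of _ 0]) (auto simp: lip_arc_def)
  show "0 \<le> arc_dist U A M v"
    unfolding arc_dist_def using assms by (intro cInf_greatest) (auto simp: lip_arc_def)
  show M: "arc_dist U A M v \<le> M"
    unfolding arc_dist_def using bdd by (intro cInf_lower) auto
  assume "lip_arc U A v L"
  then show "arc_dist U A M v \<le> L"
    using M unfolding arc_dist_def by (cases "L \<le> M") (auto intro!: cInf_lower bdd)
qed

lemma arc_dist_less:
  assumes "arc_dist U A M v < M"
  obtains L where "L \<le> M" "lip_arc U A v L"
  using cInf_lessD[OF _ assms[unfolded arc_dist_def]] by auto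

lemma arc_dist_extend:
  fixes A :: "'a::metric_space set"
  assumes geo: "geodesic (UNIV :: 'a set)" and M: "0 \<le> M"
    and c: "c = v \<or> c = w" "dist v w < \<rho>" "ball c \<rho> \<inter> U = {}"
  shows "arc_dist U A M w \<le> arc_dist U A M v + dist v w"
proof -
  have "arc_dist U A M w - dist v w \<le> L" if "L \<in> insert M {L. L \<le> M \<and> lip_arc U A v L}" for L
  proof (cases "lip_arc U A v L")
    case True
    from arc_dist_bounds(3)[OF M lip_arc_extend[OF geo True c]] show ?thesis by simp
  next
    case False
    then have "L = M" using that by auto
    then show ?thesis using arc_dist_bounds(2)[OF M, of U A w] zero_le_dist[of v w] by linarith
  qed
  then have "arc_dist U A M w - dist v w \<le> arc_dist U A M v"
    unfolding arc_dist_def[of U A M v] by (intro cInf_greatest) auto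
  then show ?thesis by simp
qed

lemma lip_at_arc_dist:
  fixes A :: "'a::metric_space set"
  assumes geo: "geodesic (UNIV :: 'a set)" and M: "0 \<le> M" and "0 < \<rho>" "ball v \<rho> \<inter> U = {}"
  shows "lip_at (arc_dist U A M) 1 v"
proof -
  have "\<bar>arc_dist U A M w - arc_dist U A M v\<bar> \<le> 1 * dist w v" if "dist w v < \<rho>" for w
    using arc_dist_extend[OF geo M _ _ assms(4), of v w A] arc_dist_extend[OF geo M _ _ assms(4), of w v A] that
    by (auto simp: dist_commute abs_le_iff)
  then show ?thesis using assms(3) unfolding lip_at_def eventually_nhds_metric by auto
qed

section \<open>Cutoffs of the balls and the gap function\<close>

definition cutoff :: "'a::metric_space \<times> real \<Rightarrow> 'a \<Rightarrow> real" where
  "cutoff B v = max 0 (min 1 (2 - dist v (fst B) / snd B))"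

lemma cutoff_lipschitz:
  assumes "0 < snd B"
  shows "\<bar>cutoff B w - cutoff B v\<bar> \<le> dist w v / snd B"
proof -
  have "\<bar>dist w (fst B) - dist v (fst B)\<bar> \<le> dist w v"
    using abs_dist_diff_le[of w "fst B" v] by (simp add: dist_commute)
  then have "\<bar>dist w (fst B) / snd B - dist v (fst B) / snd B\<bar> \<le> dist w v / snd B"
    using assms by (simp add: diff_divide_distrib[symmetric] abs_div divide_right_mono)
  then show ?thesis unfolding cutoff_def by linarith
qed

lemma cutoff_eq_0: "0 < snd B \<Longrightarrow> v \<notin> cball (fst B) (2 * snd B) \<Longrightarrow> cutoff B v = 0"
  by (simp add: cutoff_def dist_commute max_def min_def field_simps)

lemma cutoff_eq_1: "0 < snd B \<Longrightarrow> v \<in> cball (fst B) (snd B) \<Longrightarrow> cutoff B v = 1"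
  by (simp add: cutoff_def dist_commute max_def min_def field_simps)

lemma cutoff_bounds: "0 \<le> cutoff B v" "cutoff B v \<le> 1"
  by (auto simp: cutoff_def)

text \<open>Outside the doubled ball any nonnegative slope will do. The doubled ball is taken
  closed, so its complement is open and the cutoff vanishes near each point there.\<close>

lemma lip_at_cutoff:
  assumes B: "0 < snd B" and M: "0 \<le> M" and k: "0 \<le> k"
    and k1: "v \<in> cball (fst B) (2 * snd B) \<Longrightarrow> M / snd B \<le> k"
  shows "lip_at (\<lambda>w. M * cutoff B w) k v"
proof (cases "v \<in> cball (fst B) (2 * snd B)")
  case True
  have "\<bar>M * cutoff B w - M * cutoff B v\<bar> \<le> k * dist w v" for w
  proof -
    have "\<bar>M * cutoff B w - M * cutoff B v\<bar> = M * \<bar>cutoff B w - cutoff B v\<bar>"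
      using M by (simp add: abs_mult right_diff_distrib[symmetric])
    also have "\<dots> \<le> M * (dist w v / snd B)"
      using M cutoff_lipschitz[OF B] by (intro mult_left_mono) auto
    also have "\<dots> = (M / snd B) * dist w v" by simp
    also have "\<dots> \<le> k * dist w v" using k1 True by (intro mult_right_mono) auto
    finally show ?thesis .
  qed
  then show ?thesis using k by (simp add: lip_at_def)
next
  case False
  then have "\<forall>\<^sub>F w in nhds v. w \<in> - cball (fst B) (2 * snd B)"
    by (intro eventually_nhds_in_open) auto
  then have "\<forall>\<^sub>F w in nhds v. \<bar>M * cutoff B w - M * cutoff B v\<bar> \<le> k * dist w v"
    by eventually_elim (use False B k in \<open>simp add: cutoff_eq_0 del: mem_cball\<close>)
  then show ?thesis using k by (simp add: lip_at_def)
qed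

lemma lip_at_Max:
  assumes "finite I" "lip_at f0 k z" "\<And>i. i \<in> I \<Longrightarrow> lip_at (f i) k z"
  shows "lip_at (\<lambda>w. Max (insert (f0 w) ((\<lambda>i. f i w) ` I))) k z"
  using assms
proof (induction I rule: finite_induct)
  case (insert i I)
  have "Max (insert (f0 w) ((\<lambda>i. f i w) ` insert i I)) =
        max (f i w) (Max (insert (f0 w) ((\<lambda>i. f i w) ` I)))" for w
    using insert(1) by (simp add: insert_commute[of "f0 w"] del: Max_insert) (subst Max_insert; simp)
  then show ?case using lip_at_max[of "f i" k z] insert by simp
qed simp

text \<open>The cutoffs raise the value to \<open>M\<close> on the balls, across which \<open>arc_dist\<close> may jump.\<close>

definition gap_fun :: "('a::metric_space \<times> real) set \<Rightarrow> 'a set \<Rightarrow> real \<Rightarrow> 'a \<Rightarrow> real" where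
  "gap_fun BB A M v = Max (insert (arc_dist (\<Union>(ball_set ` BB)) A M v) ((\<lambda>B. M * cutoff B v) ` BB))"

text \<open>The sum stands in for a maximum of slopes: its \<open>p\<close>-th root still dominates
  1 and each slope that is active at \<open>v\<close>, and it integrates term by term.\<close>

definition gap_weight :: "real \<Rightarrow> ('a::metric_space \<times> real) set \<Rightarrow> real \<Rightarrow> 'a \<Rightarrow> real" where
  "gap_weight p BB M v = 1 + (\<Sum>B\<in>BB. (M / snd B) powr p * indicator (cball (fst B) (2 * snd B)) v)"

lemma gap_weight_ge:
  assumes "finite BB" "1 \<le> p" "0 \<le> M"
  shows "1 \<le> gap_weight p BB M v powr (1 / p)"
    and "B \<in> BB \<Longrightarrow> 0 < snd B \<Longrightarrow> v \<in> cball (fst B) (2 * snd B) \<Longrightarrow> M / snd B \<le> gap_weight p BB M v powr (1 / p)"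
proof -
  have s: "0 \<le> (\<Sum>B\<in>BB. (M / snd B) powr p * indicator (cball (fst B) (2 * snd B)) v)"
    by (intro sum_nonneg) auto
  then show "1 \<le> gap_weight p BB M v powr (1 / p)"
    using assms by (auto simp: gap_weight_def intro!: ge_one_powr_ge_zero)
  assume B: "B \<in> BB" "0 < snd B" "v \<in> cball (fst B) (2 * snd B)"
  have "(M / snd B) powr p = (M / snd B) powr p * indicator (cball (fst B) (2 * snd B)) v"
    using B(3) by simp
  also have "\<dots> \<le> (\<Sum>B\<in>BB. (M / snd B) powr p * indicator (cball (fst B) (2 * snd B)) v)"
    by (rule member_le_sum[OF B(1)]) (use assms in auto)
  also have "\<dots> \<le> gap_weight p BB M v" by (simp add: gap_weight_def)
  finally have "((M / snd B) powr p) powr (1 / p) \<le> gap_weight p BB M v powr (1 / p)"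
    using assms by (intro powr_mono2) auto
  then show "M / snd B \<le> gap_weight p BB M v powr (1 / p)"
    using assms B by (simp add: powr_powr)
qed

lemma gap_fun_bounds:
  assumes "finite BB" "0 \<le> M"
  shows "0 \<le> gap_fun BB A M v" "gap_fun BB A M v \<le> M"
proof -
  show "0 \<le> gap_fun BB A M v"
    unfolding gap_fun_def using assms arc_dist_bounds(1)[OF assms(2)]
    by (intro order_trans[OF _ Max_ge[of _ "arc_dist (\<Union>(ball_set ` BB)) A M v"]]) auto
  show "gap_fun BB A M v \<le> M"
    unfolding gap_fun_def using assms arc_dist_bounds(2)[OF assms(2)] cutoff_bounds
    by (subst Max_le_iff) (auto intro!: mult_left_le simp del: split_paired_All)
qed

lemma gap_fun_ge:
  assumes "finite BB" 
  shows "arc_dist (\<Union>(ball_set ` BB)) A M v \<le> gap_fun BB A M v"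
    and "B \<in> BB \<Longrightarrow> M * cutoff B v \<le> gap_fun BB A M v"
  unfolding gap_fun_def using assms by (auto intro!: Max_ge)

lemma gap_fun_eq_0:
  assumes "finite BB" "0 \<le> M" "\<And>B. B \<in> BB \<Longrightarrow> 0 < snd B" "v \<in> A"
    and "\<And>B. B \<in> BB \<Longrightarrow> v \<notin> cball (fst B) (2 * snd B)"
  shows "gap_fun BB A M v = 0"
proof -
  have "v \<notin> \<Union>(ball_set ` BB)"
    using assms(3,5) by (force simp: ball_set_def)
  then have "lip_arc (\<Union>(ball_set ` BB)) A v 0"
    unfolding lip_arc_def using assms(4)
    by (intro conjI exI[of _ "\<lambda>_. v"]) (auto intro!: lipschitz_onI)
  then have "arc_dist (\<Union>(ball_set ` BB)) A M v = 0"
    using arc_dist_bounds[OF assms(2)] by (metis antisym)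
  moreover have "M * cutoff B v = 0" if "B \<in> BB" for B
    using cutoff_eq_0[of B v] assms that by simp
  ultimately have "insert (arc_dist (\<Union>(ball_set ` BB)) A M v) ((\<lambda>B. M * cutoff B v) ` BB) = {0}"
    by auto
  then show ?thesis unfolding gap_fun_def by (simp only: Max_singleton)
qed

text \<open>On a closed ball \<open>gap_fun\<close> has its greatest value \<open>M\<close>, and
  nearby it is bounded below by the cutoff of that ball, so it drops with slope at most
  \<open>M / snd B\<close> however \<open>arc_dist\<close> behaves. Off the finitely many closed
  balls a whole neighbourhood misses the family, and there \<open>arc_dist\<close> is
  1-Lipschitz.\<close>

lemma lip_at_gap_fun:
  fixes A :: "'a::metric_space set"
  assumes geo: "geodesic (UNIV :: 'a set)" and BB: "finite BB" "\<And>B. B \<in> BB \<Longrightarrow> 0 < snd B"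
    and M: "0 \<le> M" and p: "1 \<le> p"
  shows "lip_at (gap_fun BB A M) (gap_weight p BB M v powr (1 / p)) v"
proof (cases "\<exists>B\<in>BB. v \<in> cball (fst B) (snd B)")
  case True
  let ?g = "gap_weight p BB M v powr (1 / p)"
  from True obtain B where B: "B \<in> BB" "v \<in> cball (fst B) (snd B)" by blast
  have r: "0 < snd B" using BB B by auto
  have "v \<in> cball (fst B) (2 * snd B)" using B(2) r by simp
  then have g: "M / snd B \<le> ?g"
    by (intro gap_weight_ge) (use BB B M p r in auto)
  have Fv: "gap_fun BB A M v = M"
    using gap_fun_ge(2)[OF BB(1) B(1), of M v A] gap_fun_bounds(2)[OF BB(1) M, of A v] cutoff_eq_1[OF r B(2)] by simp
  have "\<bar>gap_fun BB A M w - gap_fun BB A M v\<bar> \<le> ?g * dist w v" for w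
  proof -
    have "1 - cutoff B w \<le> dist w v / snd B"
      using cutoff_lipschitz[OF r, of w v] cutoff_eq_1[OF r B(2)] by linarith
    then have "M * (1 - cutoff B w) \<le> M * (dist w v / snd B)" using M by (rule mult_left_mono)
    also have "\<dots> = (M / snd B) * dist w v" by simp
    also have "\<dots> \<le> ?g * dist w v" using g by (rule mult_right_mono) simp
    finally have "M - M * cutoff B w \<le> ?g * dist w v" by (simp add: right_diff_distrib)
    then show ?thesis 
      using Fv gap_fun_ge(2)[OF BB(1) B(1), of M w A] gap_fun_bounds(2)[OF BB(1) M, of A w] by linarith
  qed
  then show ?thesis by (simp add: lip_at_def)
next
  case False
  let ?g = "gap_weight p BB M v powr (1 / p)"
  have g1: "1 \<le> ?g" by (rule gap_weight_ge) (use BB M p in auto)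
  have "closed (\<Union>B\<in>BB. cball (fst B) (snd B))" using BB by auto
  then obtain \<rho> where \<rho>: "0 < \<rho>" "ball v \<rho> \<subseteq> - (\<Union>B\<in>BB. cball (fst B) (snd B))"
    using False by (metis (no_types, lifting) ComplI UN_E open_Compl openE)
  then have "ball v \<rho> \<inter> \<Union>(ball_set ` BB) = {}"
    by (fastforce simp: ball_set_def subset_eq dest: less_imp_le)
  from lip_at_arc_dist[OF geo M \<rho>(1) this] have l0: "lip_at (arc_dist (\<Union>(ball_set ` BB)) A M) ?g v"
    by (rule lip_at_mono) (rule g1)
  show ?thesis
    unfolding gap_fun_def[abs_def]
  proof (rule lip_at_Max[OF BB(1) l0])
    fix B assume B: "B \<in> BB"
    show "lip_at (\<lambda>w. M * cutoff B w) ?g v"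
    proof (rule lip_at_cutoff[OF BB(2)[OF B] M])
      assume "v \<in> cball (fst B) (2 * snd B)"
      then show "M / snd B \<le> ?g"
        by (intro gap_weight_ge) (use BB M p B in auto)
    qed simp
  qed
qed

lemma gap_weight_measurable: "gap_weight p BB M \<in> borel_measurable borel"
  unfolding gap_weight_def[abs_def]
  by (intro borel_measurable_add borel_measurable_sum borel_measurable_times borel_measurable_const
      borel_measurable_indicator borel_closed closed_cball)

lemma gap_weight_bounded: "gap_weight p BB M v \<le> 1 + (\<Sum>B\<in>BB. (M / snd B) powr p)"
  unfolding gap_weight_def by (intro add_left_mono sum_mono) (auto simp: indicator_def)

section \<open>Consequences of the Poincare inequality\<close>

locale poincare_space =
  fixes \<mu> :: "'a::polish_space measure" and p D C \<Lambda> :: real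
  assumes sets_eq: "sets \<mu> = sets borel"
    and geo: "geodesic (UNIV :: 'a set)"
    and p_ge_1: "1 \<le> p" and D_ge_1: "1 \<le> D" and C_ge_1: "1 \<le> C" and \<Lambda>_ge_1: "1 \<le> \<Lambda>"
    and doubling: "0 < r \<Longrightarrow> 0 < emeasure \<mu> (ball x (2 * r)) \<and>
        emeasure \<mu> (ball x (2 * r)) \<le> ennreal D * emeasure \<mu> (ball x r) \<and>
        ennreal D * emeasure \<mu> (ball x r) < \<infinity>"
    and poincare: "f \<in> L1_loc \<mu> \<Longrightarrow> upper_gradient g f \<Longrightarrow> 0 < r \<Longrightarrow>
        (\<integral>\<^sup>+z\<in>ball x r. ennreal \<bar>f z - average \<mu> (ball x r) f\<bar> \<partial>completion \<mu>)
            / emeasure \<mu> (ball x r)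
        \<le> ennreal (C * r) *
          ennreal_powr ((\<integral>\<^sup>+z\<in>ball x (\<Lambda> * r). ennreal_powr (g z) p \<partial>\<mu>)
            / emeasure \<mu> (ball x (\<Lambda> * r))) (1 / p)"
begin

section \<open>Measures of balls under doubling\<close>

lemma emeasure_ball_finite: "emeasure \<mu> (ball x r) < \<infinity>"
proof (cases "0 < r")
  case True
  then have "ennreal D * emeasure \<mu> (ball x r) < \<infinity>" using doubling by blast
  then show ?thesis using D_ge_1 by (auto simp: ennreal_mult_less_top)
qed (simp add: ball_empty)

lemma emeasure_ball: "emeasure \<mu> (ball x r) = ennreal (measure \<mu> (ball x r))"
  using emeasure_ball_finite[of x r] by (intro emeasure_eq_ennreal_measure) auto

lemma measure_ball_pos: "0 < r \<Longrightarrow> 0 < measure \<mu> (ball x r)"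
  using doubling[of "r / 2" x] by (simp add: emeasure_ball)

lemma emeasure_subset_ball: 
  assumes "A \<in> sets borel" "A \<subseteq> ball x r"
  shows "emeasure \<mu> A = ennreal (measure \<mu> A)"
proof -
  have "emeasure \<mu> A \<le> emeasure \<mu> (ball x r)"
    using assms by (intro emeasure_mono) (auto simp: sets_eq)
  then show ?thesis using emeasure_ball_finite[of x r]
    by (intro emeasure_eq_ennreal_measure) (auto simp: top_unique)
qed

lemma measure_mono_ball:
  assumes "A \<in> sets borel" "A \<subseteq> B" "B \<in> sets borel" "B \<subseteq> ball x r"
  shows "measure \<mu> A \<le> measure \<mu> B"
proof -
  have "ennreal (measure \<mu> A) \<le> ennreal (measure \<mu> B)"
    using assms emeasure_subset_ball[of A x r] emeasure_subset_ball[of B x r]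
      emeasure_mono[of A B \<mu>] by (auto simp: sets_eq)
  then show ?thesis by simp
qed

lemma measure_ball_mono: "ball x r \<subseteq> ball y s \<Longrightarrow> measure \<mu> (ball x r) \<le> measure \<mu> (ball y s)"
  by (rule measure_mono_ball[where x = y and r = s]) auto

lemma measure_ball_double: "0 < r \<Longrightarrow> measure \<mu> (ball x (2 * r)) \<le> D * measure \<mu> (ball x r)"
  using doubling[of r x] D_ge_1 by (simp add: emeasure_ball ennreal_mult[symmetric])

lemma measure_ball_double_power:
  assumes "0 < r"
  shows "measure \<mu> (ball x (2 ^ n * r)) \<le> D ^ n * measure \<mu> (ball x r)"
proof (induction n)
  case (Suc n)
  have "measure \<mu> (ball x (2 ^ Suc n * r)) \<le> D * measure \<mu> (ball x (2 ^ n * r))"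
    using measure_ball_double[of "2 ^ n * r" x] assms by (simp add: mult.assoc)
  also have "\<dots> \<le> D * (D ^ n * measure \<mu> (ball x r))"
    using Suc D_ge_1 by (intro mult_left_mono) auto
  finally show ?case by (simp add: mult.assoc)
qed simp

text \<open>No number \<open>a\<close> is closer than \<open>M / 2\<close> to both 0 and
  \<open>M\<close>, so all of \<open>A\<close> or all of \<open>E\<close> contributes. The average
  of \<open>F\<close> therefore never has to be computed.\<close>

lemma nn_integral_gap_ge:
  fixes F :: "'a \<Rightarrow> real"
  assumes A: "A \<in> sets borel" "A \<subseteq> ball x r" "\<And>z. z \<in> A \<Longrightarrow> F z = 0"
    and E: "E \<in> sets borel" "E \<subseteq> ball x r" "\<And>z. z \<in> E \<Longrightarrow> F z = M"
    and M: "0 \<le> M"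
  shows "ennreal (M / 2 * min (measure \<mu> A) (measure \<mu> E))
     \<le> (\<integral>\<^sup>+z\<in>ball x r. ennreal \<bar>F z - a\<bar> \<partial>completion \<mu>)"
proof -
  have *: "ennreal (M / 2 * measure \<mu> S) \<le> (\<integral>\<^sup>+z\<in>ball x r. ennreal \<bar>F z - a\<bar> \<partial>completion \<mu>)"
    if S: "S \<in> sets borel" "S \<subseteq> ball x r" "\<And>z. z \<in> S \<Longrightarrow> M / 2 \<le> \<bar>F z - a\<bar>" for S
  proof -
    have S': "S \<in> sets \<mu>" "S \<in> sets (completion \<mu>)" using S by (auto simp: sets_eq)
    have "ennreal (M / 2 * measure \<mu> S) = ennreal (M / 2) * emeasure (completion \<mu>) S"
      using S' M emeasure_subset_ball[OF S(1,2)] by (simp add: ennreal_mult[symmetric])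
    also have "\<dots> = (\<integral>\<^sup>+z. ennreal (M / 2) * indicator S z \<partial>completion \<mu>)"
      using S' by (simp add: nn_integral_cmult_indicator)
    also have "\<dots> \<le> (\<integral>\<^sup>+z\<in>ball x r. ennreal \<bar>F z - a\<bar> \<partial>completion \<mu>)"
      by (rule nn_integral_mono) (use S in \<open>auto simp: indicator_def intro!: ennreal_leI\<close>)
    finally show ?thesis .
  qed
  show ?thesis
  proof (cases "M / 2 \<le> \<bar>a\<bar>")
    case True
    have "ennreal (M / 2 * min (measure \<mu> A) (measure \<mu> E)) \<le> ennreal (M / 2 * measure \<mu> A)"
      using M by (intro ennreal_leI mult_left_mono) auto
    also have "\<dots> \<le> (\<integral>\<^sup>+z\<in>ball x r. ennreal \<bar>F z - a\<bar> \<partial>completion \<mu>)"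
      by (rule *) (use A True in auto)
    finally show ?thesis .
  next
    case False
    have "ennreal (M / 2 * min (measure \<mu> A) (measure \<mu> E)) \<le> ennreal (M / 2 * measure \<mu> E)"
      using M by (intro ennreal_leI mult_left_mono) auto
    also have "\<dots> \<le> (\<integral>\<^sup>+z\<in>ball x r. ennreal \<bar>F z - a\<bar> \<partial>completion \<mu>)"
      by (rule *) (use E False in \<open>auto simp: abs_if split: if_splits\<close>)
    finally show ?thesis .
  qed
qed

lemma bounded_continuous_L1_loc:
  assumes "continuous_on UNIV F" "\<And>z. \<bar>F z\<bar> \<le> M"
  shows "F \<in> L1_loc \<mu>"
proof -
  have F: "F \<in> borel_measurable \<mu>"
    using borel_measurable_continuous_onI[OF assms(1)] sets_eq by (simp cong: measurable_cong_sets)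
  have F': "F \<in> borel_measurable (completion \<mu>)" by (rule measurable_completion[OF F])
  have "set_integrable (completion \<mu>) (ball x 1) F" for x
    unfolding set_integrable_def
    using F' emeasure_ball_finite[of x 1] assms(2)
    by (intro integrableI_bounded_set_indicator[where B = M]) (auto simp: sets_eq)
  then show ?thesis using F' unfolding L1_loc_def by (auto intro: exI[of _ 1])
qed

text \<open>The weight \<open>w\<close> is the \<open>p\<close>-th power of the upper gradient, so
  the exponents \<open>1 / p\<close> and \<open>p\<close> cancel under the integral and
  \<open>W\<close> bounds a mean of \<open>w\<close> itself.\<close>

lemma poincare_gap:
  fixes F w :: "'a \<Rightarrow> real"
  assumes F: "\<And>z. lip_at F (w z powr (1 / p)) z" "\<And>z. 0 \<le> F z" "\<And>z. F z \<le> M"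
    and w: "w \<in> borel_measurable borel" "\<And>z. 0 \<le> w z" "\<And>z. w z \<le> K"
    and A: "A \<in> sets borel" "A \<subseteq> ball x r" "\<And>z. z \<in> A \<Longrightarrow> F z = 0"
    and E: "E \<in> sets borel" "E \<subseteq> ball x r" "\<And>z. z \<in> E \<Longrightarrow> F z = M"
    and r: "0 < r" and W: "0 \<le> W"
      "(\<integral>\<^sup>+z\<in>ball x (\<Lambda> * r). ennreal (w z) \<partial>\<mu>) \<le> ennreal (W * measure \<mu> (ball x (\<Lambda> * r)))"
  shows "M / 2 * min (measure \<mu> A) (measure \<mu> E) \<le> C * r * W powr (1 / p) * measure \<mu> (ball x r)"
proof -
  let ?g = "\<lambda>z. ennreal (w z powr (1 / p))"
  let ?m = "measure \<mu> (ball x r)" and ?m' = "measure \<mu> (ball x (\<Lambda> * r))"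
  have M: "0 \<le> M" using F(2,3) order_trans by blast
  have pos: "0 < ?m" "0 < ?m'" using r \<Lambda>_ge_1 by (auto intro!: measure_ball_pos)
  have "F \<in> L1_loc \<mu>"
    using F(2,3) by (intro bounded_continuous_L1_loc[of F M] lip_at_continuous[OF F(1)]) auto
  moreover have "upper_gradient ?g F"
  proof (rule lip_at_upper_gradient[OF F(1)])
    show "(\<lambda>z. w z powr (1 / p)) \<in> borel_measurable borel" using w(1) by measurable
    show "w z powr (1 / p) \<le> K powr (1 / p)" for z
      using w(2,3) p_ge_1 by (intro powr_mono2) auto
  qed
  ultimately have P: "(\<integral>\<^sup>+z\<in>ball x r. ennreal \<bar>F z - average \<mu> (ball x r) F\<bar> \<partial>completion \<mu>)
            / ennreal ?m
        \<le> ennreal (C * r) *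
          ennreal_powr ((\<integral>\<^sup>+z\<in>ball x (\<Lambda> * r). ennreal_powr (?g z) p \<partial>\<mu>) / ennreal ?m') (1 / p)"
    using poincare[of F ?g r x] r by (simp add: emeasure_ball)
  have gp: "ennreal_powr (?g z) p = ennreal (w z)" for z
    using w(2)[of z] p_ge_1 by (simp add: ennreal_powr_def powr_powr)
  have "ennreal (M / 2 * min (measure \<mu> A) (measure \<mu> E) / ?m)
     \<le> (\<integral>\<^sup>+z\<in>ball x r. ennreal \<bar>F z - average \<mu> (ball x r) F\<bar> \<partial>completion \<mu>) / ennreal ?m"
  proof -
    have "ennreal (M / 2 * min (measure \<mu> A) (measure \<mu> E) / ?m) =
        ennreal (M / 2 * min (measure \<mu> A) (measure \<mu> E)) / ennreal ?m"
      using pos M by (intro divide_ennreal[symmetric]) auto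
    also have "\<dots> \<le> (\<integral>\<^sup>+z\<in>ball x r. ennreal \<bar>F z - average \<mu> (ball x r) F\<bar> \<partial>completion \<mu>) / ennreal ?m"
      by (intro divide_right_mono_ennreal nn_integral_gap_ge A E M)
    finally show ?thesis .
  qed
  also note P
  also have "(\<integral>\<^sup>+z\<in>ball x (\<Lambda> * r). ennreal_powr (?g z) p \<partial>\<mu>) / ennreal ?m' \<le> ennreal W"
  proof -
    have "(\<integral>\<^sup>+z\<in>ball x (\<Lambda> * r). ennreal_powr (?g z) p \<partial>\<mu>) / ennreal ?m' \<le> ennreal (W * ?m') / ennreal ?m'"
      unfolding gp by (intro divide_right_mono_ennreal W)
    also have "\<dots> = ennreal W" using W pos by (simp add: divide_ennreal)
    finally show ?thesis .
  qed
  then have "ennreal_powr ((\<integral>\<^sup>+z\<in>ball x (\<Lambda> * r). ennreal_powr (?g z) p \<partial>\<mu>) / ennreal ?m') (1 / p) \<le> ennreal (W powr (1 / p))"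
    using p_ge_1 W(1) unfolding ennreal_powr_def
    by (auto simp: top_unique enn2real_leI intro!: ennreal_leI powr_mono2)
  then have "ennreal (C * r) *
          ennreal_powr ((\<integral>\<^sup>+z\<in>ball x (\<Lambda> * r). ennreal_powr (?g z) p \<partial>\<mu>) / ennreal ?m') (1 / p)
       \<le> ennreal (C * r) * ennreal (W powr (1 / p))"
    by (intro mult_left_mono) auto
  finally have "ennreal (M / 2 * min (measure \<mu> A) (measure \<mu> E) / ?m) \<le> ennreal (C * r * W powr (1 / p))"
    using C_ge_1 r by (simp add: ennreal_mult)
  then have "M / 2 * min (measure \<mu> A) (measure \<mu> E) / ?m \<le> C * r * W powr (1 / p)"
    using C_ge_1 r by (subst (asm) ennreal_le_iff) auto
  then show ?thesis using pos by (simp add: field_simps)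
qed

text \<open>A closed doubled ball lies in the open ball with four times the radius of
  \<open>B\<close>, and two doublings bound the measure of the latter by \<open>D ^ 2\<close> times
  that of \<open>B\<close>. This turns the \<open>p\<close>-th powers of the slopes into
  contents.\<close>

lemma nn_integral_gap_weight:
  assumes "finite BB" "\<And>B. B \<in> BB \<Longrightarrow> 0 < snd B" "0 < M"
  shows "(\<integral>\<^sup>+z\<in>ball x r. ennreal (gap_weight p BB M z) \<partial>\<mu>) \<le> ennreal (measure \<mu> (ball x r) +
    M powr p * D ^ 2 * (\<Sum>B\<in>{B\<in>BB. cball (fst B) (2 * snd B) \<inter> ball x r \<noteq> {}}. measure \<mu> (ball_set B) / snd B powr p))"
proof -
  let ?c = "\<lambda>B. cball (fst B) (2 * snd B)" and ?b = "ball x r"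
  let ?I = "{B\<in>BB. ?c B \<inter> ?b \<noteq> {}}"
  have "ennreal (gap_weight p BB M z) * indicator ?b z
      = indicator ?b z + (\<Sum>B\<in>BB. ennreal ((M / snd B) powr p) * indicator (?c B \<inter> ?b) z)" for z
  proof (cases "z \<in> ?b")
    case True
    have "ennreal (gap_weight p BB M z) = 1 + ennreal (\<Sum>B\<in>BB. (M / snd B) powr p * indicator (?c B) z)"
      unfolding gap_weight_def by (subst ennreal_plus) (auto intro!: sum_nonneg)
    also have "\<dots> = 1 + (\<Sum>B\<in>BB. ennreal ((M / snd B) powr p * indicator (?c B) z))"
      by (subst sum_ennreal) auto
    also have "(\<Sum>B\<in>BB. ennreal ((M / snd B) powr p * indicator (?c B) z)) = 
       (\<Sum>B\<in>BB. ennreal ((M / snd B) powr p) * indicator (?c B \<inter> ?b) z)"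
      by (rule sum.cong) (use True in \<open>auto simp: indicator_def\<close>)
    finally show ?thesis using True by simp
  qed simp
  moreover have sets [measurable]: "?b \<in> sets \<mu>" "?c B \<inter> ?b \<in> sets \<mu>" for B
    by (simp_all add: sets_eq)
  ultimately have "(\<integral>\<^sup>+z\<in>?b. ennreal (gap_weight p BB M z) \<partial>\<mu>) = 
     (\<integral>\<^sup>+z. indicator ?b z + (\<Sum>B\<in>BB. ennreal ((M / snd B) powr p) * indicator (?c B \<inter> ?b) z) \<partial>\<mu>)"
    by simp
  also have "\<dots> = (\<integral>\<^sup>+z. indicator ?b z \<partial>\<mu>) +
      (\<integral>\<^sup>+z. (\<Sum>B\<in>BB. ennreal ((M / snd B) powr p) * indicator (?c B \<inter> ?b) z) \<partial>\<mu>)"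
    by (rule nn_integral_add) measurable
  also have "(\<integral>\<^sup>+z. (\<Sum>B\<in>BB. ennreal ((M / snd B) powr p) * indicator (?c B \<inter> ?b) z) \<partial>\<mu>) =
      (\<Sum>B\<in>BB. \<integral>\<^sup>+z. ennreal ((M / snd B) powr p) * indicator (?c B \<inter> ?b) z \<partial>\<mu>)"
    by (rule nn_integral_sum) measurable
  also have "\<dots> = (\<Sum>B\<in>BB. ennreal ((M / snd B) powr p) * emeasure \<mu> (?c B \<inter> ?b))"
    by (intro sum.cong refl nn_integral_cmult_indicator sets)
  also have "(\<integral>\<^sup>+z. indicator ?b z \<partial>\<mu>) = emeasure \<mu> ?b"
    by (rule nn_integral_indicator) (rule sets)
  also have "(\<Sum>B\<in>BB. ennreal ((M / snd B) powr p) * emeasure \<mu> (?c B \<inter> ?b))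
      = (\<Sum>B\<in>?I. ennreal ((M / snd B) powr p) * emeasure \<mu> (?c B \<inter> ?b))"
    by (rule sum.mono_neutral_right) (use assms(1) in auto)
  also have "emeasure \<mu> ?b + \<dots> \<le> emeasure \<mu> ?b + (\<Sum>B\<in>?I. ennreal (M powr p * D ^ 2 * (measure \<mu> (ball_set B) / snd B powr p)))"
  proof (intro add_left_mono sum_mono)
    fix B assume "B \<in> ?I"
    then have B: "0 < snd B" using assms by auto
    have "emeasure \<mu> (?c B \<inter> ?b) \<le> emeasure \<mu> (ball (fst B) (2 ^ 2 * snd B))"
      using B by (intro emeasure_mono) (auto simp: sets_eq)
    also have "\<dots> \<le> ennreal (D ^ 2 * measure \<mu> (ball_set B))"
      unfolding emeasure_ball ball_set_def by (intro ennreal_leI measure_ball_double_power B)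
    finally have "ennreal ((M / snd B) powr p) * emeasure \<mu> (?c B \<inter> ?b) \<le> 
       ennreal ((M / snd B) powr p) * ennreal (D ^ 2 * measure \<mu> (ball_set B))"
      by (intro mult_left_mono) auto
    also have "\<dots> = ennreal (M powr p * D ^ 2 * (measure \<mu> (ball_set B) / snd B powr p))"
      using B assms(3) by (simp add: ennreal_mult[symmetric] powr_divide)
    finally show "ennreal ((M / snd B) powr p) * emeasure \<mu> (?c B \<inter> ?b) \<le> \<dots>" .
  qed
  also have "(\<Sum>B\<in>?I. ennreal (M powr p * D ^ 2 * (measure \<mu> (ball_set B) / snd B powr p))) =
      ennreal (M powr p * D ^ 2 * (\<Sum>B\<in>?I. measure \<mu> (ball_set B) / snd B powr p))"
    by (subst sum_distrib_left, rule sum_ennreal)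
       (intro mult_nonneg_nonneg divide_nonneg_nonneg zero_le_power2 powr_ge_zero measure_nonneg)
  finally show ?thesis
    unfolding emeasure_ball by (subst ennreal_plus) (auto intro!: sum_nonneg mult_nonneg_nonneg)
qed

text \<open>The constant 65 just exceeds the 64 produced by the Poincare inequality on \<open>ball z (4 * r)\<close>.\<close>

definition reach_const :: real where "reach_const = 65 * C * D ^ 3"

lemma reach_const_ge: "65 \<le> reach_const"
proof -
  have "1 \<le> C * D ^ 3" using mult_mono[OF C_ge_1 one_le_power[OF D_ge_1, of 3]] C_ge_1 by simp
  then show ?thesis by (simp add: reach_const_def)
qed

text \<open>Everything is compared with \<open>ball z (4 * r)\<close>, which contains both balls and
  lies in \<open>ball z' (8 * r')\<close>. If the unreached part exceeded a quarter, it and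
  \<open>A\<close> would each carry at least the share \<open>1 / (4 * D ^ 3)\<close> of that ball,
  too much for two sets separated by a gap of height \<open>M\<close>.\<close>

lemma reach_step:
  assumes BB: "finite BB" "\<And>B. B \<in> BB \<Longrightarrow> 0 < snd B"
    and r: "0 < r" "dist z z' \<le> r" "r \<le> r'" "r' \<le> 2 * r"
    and A: "A \<in> sets borel" "A \<subseteq> ball z r" "A \<inter> (\<Union>B\<in>BB. cball (fst B) (2 * snd B)) = {}"
      "measure \<mu> (ball z r) \<le> 2 * measure \<mu> A"
    and small: "(reach_const * r) powr p * D ^ 2 * 
      (\<Sum>B\<in>{B\<in>BB. cball (fst B) (2 * snd B) \<inter> ball z (\<Lambda> * (4 * r)) \<noteq> {}}. measure \<mu> (ball_set B) / snd B powr p)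
      \<le> measure \<mu> (ball z r)"
  shows "\<exists>R. R \<in> sets borel \<and> R \<subseteq> ball z' r' \<and>
    4 * measure \<mu> (ball z' r' - R) \<le> measure \<mu> (ball z' r') \<and>
    (\<forall>v\<in>R. \<exists>L\<le>reach_const * r. lip_arc (\<Union>(ball_set ` BB)) A v L)"
proof -
  define M where "M = reach_const * r"
  have M: "0 < M" using reach_const_ge r by (simp add: M_def)
  let ?F = "gap_fun BB A M"
  have lip: "lip_at ?F (gap_weight p BB M v powr (1 / p)) v" for v
    using lip_at_gap_fun[OF geo BB _ p_ge_1] M by auto
  have bds: "0 \<le> ?F v" "?F v \<le> M" for v using gap_fun_bounds[OF BB(1)] M by auto
  have cont: "continuous_on UNIV ?F" by (rule lip_at_continuous[OF lip])
  \<comment> \<open>A sublevel set rather than the set of all reachable points: it is open because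
    \<open>?F\<close> is continuous, hence measurable, and on its complement in the ball
    \<open>?F\<close> equals \<open>M\<close>.\<close>
  define R where "R = ball z' r' \<inter> {v. ?F v < M}"
  define E where "E = ball z' r' - R"
  have "open {v. ?F v < M}" by (rule open_Collect_less[OF cont]) simp
  then have Rm: "R \<in> sets borel" by (simp add: R_def open_Int)
  have Em: "E \<in> sets borel" using Rm by (simp add: E_def)
  have reach: "\<exists>L\<le>reach_const * r. lip_arc (\<Union>(ball_set ` BB)) A v L" if v: "v \<in> R" for v
  proof -
    have "arc_dist (\<Union>(ball_set ` BB)) A M v < M"
      using gap_fun_ge(1)[OF BB(1), of A M v] v by (auto simp: R_def)
    then show ?thesis using arc_dist_less unfolding M_def by metis
  qed
  have sub: "ball z r \<subseteq> ball z (4 * r)" "ball z' r' \<subseteq> ball z (4 * r)" "ball z (4 * r) \<subseteq> ball z' (8 * r')"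
    "ball z r \<subseteq> ball z (\<Lambda> * (4 * r))"
  proof -
    show "ball z r \<subseteq> ball z (4 * r)" using r by auto
    show "ball z' r' \<subseteq> ball z (4 * r)"
    proof
      fix v assume "v \<in> ball z' r'"
      then show "v \<in> ball z (4 * r)" using r dist_triangle[of z v z'] by simp
    qed
    show "ball z (4 * r) \<subseteq> ball z' (8 * r')"
    proof
      fix v assume "v \<in> ball z (4 * r)"
      then show "v \<in> ball z' (8 * r')" using r dist_triangle[of z' v z] by (simp add: dist_commute)
    qed
    have "1 * r \<le> \<Lambda> * (4 * r)" using r \<Lambda>_ge_1 by (intro mult_mono) auto
    then show "ball z r \<subseteq> ball z (\<Lambda> * (4 * r))" by auto
  qed
  let ?Q = "measure \<mu> (ball z (4 * r))" and ?Q' = "measure \<mu> (ball z (\<Lambda> * (4 * r)))"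
  have gap: "M / 2 * min (measure \<mu> A) (measure \<mu> E) \<le> C * (4 * r) * 2 powr (1 / p) * ?Q"
  proof (rule poincare_gap[OF lip bds])
    show "gap_weight p BB M \<in> borel_measurable borel" by (rule gap_weight_measurable)
    show "0 \<le> gap_weight p BB M v" for v
      unfolding gap_weight_def by (intro add_nonneg_nonneg sum_nonneg) auto
    show "gap_weight p BB M v \<le> 1 + (\<Sum>B\<in>BB. (M / snd B) powr p)" for v by (rule gap_weight_bounded)
    show "A \<in> sets borel" "A \<subseteq> ball z (4 * r)" using A sub by auto
    show "?F v = 0" if "v \<in> A" for v 
      by (rule gap_fun_eq_0) (use BB M A(3) that in \<open>auto simp del: mem_cball\<close>)
    show "E \<in> sets borel" by (rule Em)
    show "E \<subseteq> ball z (4 * r)" using sub by (auto simp: E_def)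
    show "?F v = M" if "v \<in> E" for v using that bds(2)[of v] by (auto simp: E_def R_def)
    show "0 < 4 * r" "(0::real) \<le> 2" using r by auto
    \<comment> \<open>Small content makes the cutoffs contribute no more than the constant 1 does,
      so the mean of the weight is at most 2.\<close>
    have "(\<integral>\<^sup>+z\<in>ball z (\<Lambda> * (4 * r)). ennreal (gap_weight p BB M z) \<partial>\<mu>) \<le> ennreal (?Q' + measure \<mu> (ball z r))"
    proof (rule order_trans[OF nn_integral_gap_weight[OF BB(1) _ M] ennreal_leI])
      show "?Q' + M powr p * D ^ 2 * (\<Sum>B\<in>{B\<in>BB. cball (fst B) (2 * snd B) \<inter> ball z (\<Lambda> * (4 * r)) \<noteq> {}}.
          measure \<mu> (ball_set B) / snd B powr p) \<le> ?Q' + measure \<mu> (ball z r)"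
        unfolding M_def by (rule add_left_mono[OF small])
    qed (rule BB(2))
    also have "\<dots> \<le> ennreal (2 * ?Q')"
      using measure_ball_mono[OF sub(4)] by (intro ennreal_leI) auto
    finally show "(\<integral>\<^sup>+z\<in>ball z (\<Lambda> * (4 * r)). ennreal (gap_weight p BB M z) \<partial>\<mu>) \<le> ennreal (2 * ?Q')" .
  qed
  have Q: "0 < ?Q" using r by (intro measure_ball_pos) auto
  have "4 * measure \<mu> E \<le> measure \<mu> (ball z' r')"
  proof (rule ccontr)
    assume "\<not> ?thesis"
    then have E4: "measure \<mu> (ball z' r') \<le> 4 * measure \<mu> E" by simp
    have D3: "0 < D ^ 3" "D ^ 2 \<le> D ^ 3" using D_ge_1 by (auto intro: power_increasing)
    have "?Q \<le> D ^ 2 * measure \<mu> (ball z r)"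
      using measure_ball_double_power[OF r(1), of z 2] by simp
    also have "\<dots> \<le> D ^ 3 * (4 * measure \<mu> A)"
      using A(4) D3 by (intro mult_mono) (auto intro: order_trans)
    finally have QA: "?Q / (4 * D ^ 3) \<le> measure \<mu> A" using D3 by (simp add: field_simps)
    have "?Q \<le> measure \<mu> (ball z' (2 ^ 3 * r'))" using measure_ball_mono[OF sub(3)] by simp
    also have "\<dots> \<le> D ^ 3 * measure \<mu> (ball z' r')" by (rule measure_ball_double_power) (use r in auto)
    also have "\<dots> \<le> D ^ 3 * (4 * measure \<mu> E)" using E4 D3 by (intro mult_left_mono) auto
    finally have QE: "?Q / (4 * D ^ 3) \<le> measure \<mu> E" using D3 by (simp add: field_simps)
    have "M / 2 * (?Q / (4 * D ^ 3)) \<le> M / 2 * min (measure \<mu> A) (measure \<mu> E)"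
      using QA QE M by (intro mult_left_mono) auto
    also note gap
    also have "C * (4 * r) * 2 powr (1 / p) * ?Q \<le> C * (4 * r) * 2 * ?Q"
    proof -
      have "2 powr (1 / p) \<le> 2 powr (1::real)" using p_ge_1 by (intro powr_mono) auto
      then show ?thesis using C_ge_1 r Q by (intro mult_right_mono mult_left_mono) auto
    qed
    \<comment> \<open>Here 64 is \<open>2 * 4 * 4 * 2\<close>: from \<open>M / 2\<close>, from the
      share \<open>1 / (4 * D ^ 3)\<close>, from the radius \<open>4 * r\<close>, and from the bound
      2 for \<open>2 powr (1 / p)\<close>.\<close>
    finally have "M * ?Q \<le> (64 * C * r * D ^ 3) * ?Q" using D3 by (simp add: field_simps)
    then have "M \<le> 64 * C * r * D ^ 3" using Q by simp
    moreover have "0 < C * r * D ^ 3" using C_ge_1 r D3 by simp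
    ultimately show False by (simp add: M_def reach_const_def mult_ac)
  qed
  moreover have "R \<subseteq> ball z' r'" by (simp add: R_def)
  ultimately show ?thesis using Rm reach unfolding E_def by blast
qed

end

section \<open>Uniform curves avoiding finitely many balls\<close>

definition small_content :: "'a::metric_space measure \<Rightarrow> real \<Rightarrow> ('a \<times> real) set \<Rightarrow> real \<Rightarrow> 'a \<Rightarrow> real \<Rightarrow> bool" where
  "small_content \<mu> p BB \<epsilon> x d \<longleftrightarrow> (\<forall>r\<in>{0<..d}.
     (\<Sum>B\<in>{B\<in>BB. ball_set B \<inter> ball x r \<noteq> {}}. measure \<mu> (ball_set B) / snd B powr p)
       \<le> \<epsilon> * measure \<mu> (ball x r) / r powr p)"

text \<open>As \<open>s\<close> bounds the length of the initial piece, the last inequality is a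
  chord-arc condition at the endpoint \<open>x\<close> alone.\<close>

definition tame_arc :: "'a::metric_space set \<Rightarrow> real \<Rightarrow> 'a \<Rightarrow> (real \<Rightarrow> 'a) \<Rightarrow> real \<Rightarrow> bool" where
  "tame_arc U \<kappa> x \<gamma> L \<longleftrightarrow> 0 \<le> L \<and> 1-lipschitz_on {0..L} \<gamma> \<and> \<gamma> 0 = x \<and>
     (\<forall>s\<in>{0..L}. \<gamma> s \<notin> U \<and> s \<le> \<kappa> * dist x (\<gamma> s))"

context poincare_space
begin

text \<open>Chosen so that \<open>\<Lambda> * (4 * step_ratio) \<le> 1\<close> and \<open>(reach_const + 1) * step_ratio \<le> 1 / 2\<close>.\<close>

definition step_ratio :: real where "step_ratio = 1 / (4 * (reach_const + \<Lambda>))"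

text \<open>So many doublings carry the radius \<open>step_ratio * s\<close> to at least
  \<open>5 * s\<close>; if \<open>dist x z = s\<close>, the enlarged ball about \<open>z\<close>
  contains \<open>ball x (4 * s)\<close>.\<close>

definition steps :: nat where "steps = (SOME n. 5 / step_ratio \<le> 2 ^ n)"

text \<open>The power \<open>D ^ steps\<close> pays for the change from
  \<open>ball x (4 * s)\<close> to \<open>ball z (step_ratio * s)\<close>, \<open>D ^ 2\<close> for
  the doubled balls, and 4 leaves the quarter that a step may lose.\<close>

definition content_bound :: real where "content_bound = 1 / (4 * D ^ (steps + 2))"

lemma step_ratio:
  "0 < step_ratio" "\<Lambda> * (4 * step_ratio) \<le> 1" "(reach_const + 1) * step_ratio \<le> 1 / 2"
  "reach_const * step_ratio \<le> 1" "step_ratio \<le> 1 / 2"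
proof -
  have pos: "0 < reach_const + \<Lambda>" using reach_const_ge \<Lambda>_ge_1 by simp
  then show p: "0 < step_ratio" by (simp add: step_ratio_def)
  have K: "0 \<le> reach_const * step_ratio" using p reach_const_ge by simp
  show "\<Lambda> * (4 * step_ratio) \<le> 1" "(reach_const + 1) * step_ratio \<le> 1 / 2"
    using pos reach_const_ge \<Lambda>_ge_1 by (auto simp: step_ratio_def field_simps)
  then show "reach_const * step_ratio \<le> 1" "step_ratio \<le> 1 / 2"
    using p K by (auto simp: distrib_right)
qed

lemma steps: "5 \<le> 2 ^ steps * step_ratio"
proof -
  obtain n where "5 / step_ratio < 2 ^ n" using real_arch_pow[of 2 "5 / step_ratio"] by auto
  then have "\<exists>n. 5 / step_ratio \<le> 2 ^ n" by (auto intro: less_imp_le)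
  then have "5 / step_ratio \<le> 2 ^ steps" unfolding steps_def by (rule someI_ex)
  then show ?thesis using step_ratio(1) by (simp add: field_simps)
qed

text \<open>The ball about \<open>z\<close> in \<open>I\<close> has radius at most \<open>s\<close>.
  A doubled ball meeting it has its centre within \<open>2 * s + 2 * snd B\<close> of
  \<open>x\<close>, but \<open>x\<close> is outside the fourfold ball, so \<open>snd B < s\<close>
  and the centre lies in \<open>ball x (4 * s)\<close>. Hence the hypothesis at radius
  \<open>4 * s\<close> counts all of \<open>I\<close>.\<close>

lemma content_near:
  assumes BB: "finite BB" "\<And>B. B \<in> BB \<Longrightarrow> 0 < snd B" 
    and x: "\<And>B. B \<in> BB \<Longrightarrow> x \<notin> ball (fst B) (4 * snd B)"
    and small: "small_content \<mu> p BB content_bound x (4 * h)"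
    and z: "dist x z = s" "0 < s" "s \<le> h"
  defines "I \<equiv> {B\<in>BB. cball (fst B) (2 * snd B) \<inter> ball z (\<Lambda> * (4 * (step_ratio * s))) \<noteq> {}}"
  shows "4 * (s powr p * D ^ 2 * (\<Sum>B\<in>I. measure \<mu> (ball_set B) / snd B powr p))
           \<le> measure \<mu> (ball z (step_ratio * s))"
    and "4 * measure \<mu> (ball z (step_ratio * s) \<inter> (\<Union>B\<in>BB. cball (fst B) (2 * snd B)))
           \<le> measure \<mu> (ball z (step_ratio * s))"
proof -
  let ?m = "measure \<mu> (ball z (step_ratio * s))"
  have rs: "\<Lambda> * (4 * (step_ratio * s)) \<le> s"
    using mult_right_mono[OF step_ratio(2), of s] z by (simp add: mult_ac)
  have I: "snd B \<le> s \<and> ball_set B \<inter> ball x (4 * s) \<noteq> {}" if B: "B \<in> I" for B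
  proof -
    obtain u where u: "dist (fst B) u \<le> 2 * snd B" "dist z u < \<Lambda> * (4 * (step_ratio * s))"
      using B by (auto simp: I_def)
    have "dist x (fst B) \<le> dist x z + (dist z u + dist u (fst B))"
      by (meson add_left_mono dist_triangle order_trans)
    moreover have "dist u (fst B) \<le> 2 * snd B" using u(1) by (simp add: dist_commute)
    ultimately have *: "dist x (fst B) < 2 * s + 2 * snd B" using u(2) z(1) rs by linarith
    have B4: "4 * snd B \<le> dist x (fst B)" "0 < snd B"
      using x[of B] BB(2)[of B] B by (auto simp: I_def dist_commute)
    then have "fst B \<in> ball_set B \<inter> ball x (4 * s)" using * by (auto simp: ball_set_def)
    then show ?thesis using * B4 by auto
  qed
  have finI: "finite I" using BB by (simp add: I_def)
  let ?h = "\<lambda>B. measure \<mu> (ball_set B) / snd B powr p"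
  have "(\<Sum>B\<in>I. ?h B) \<le> (\<Sum>B\<in>{B\<in>BB. ball_set B \<inter> ball x (4 * s) \<noteq> {}}. ?h B)"
  proof (rule sum_mono2)
    show "I \<subseteq> {B\<in>BB. ball_set B \<inter> ball x (4 * s) \<noteq> {}}"
    proof
      fix B assume "B \<in> I"
      then show "B \<in> {B\<in>BB. ball_set B \<inter> ball x (4 * s) \<noteq> {}}" using I[of B] by (simp add: I_def)
    qed
  qed (use BB in auto)
  also have "\<dots> \<le> content_bound * measure \<mu> (ball x (4 * s)) / (4 * s) powr p"
    using small z by (auto simp: small_content_def)
  also have "\<dots> \<le> content_bound * (D ^ steps * ?m) / s powr p"
  proof (rule frac_le)
    have "ball x (4 * s) \<subseteq> ball z (2 ^ steps * (step_ratio * s))"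
    proof
      fix u assume u: "u \<in> ball x (4 * s)"
      have "dist z u \<le> dist x z + dist x u" by (metis dist_commute dist_triangle)
      moreover have "5 * s \<le> 2 ^ steps * (step_ratio * s)"
        using mult_right_mono[OF steps, of s] z by (simp add: mult_ac)
      moreover have "dist x u < 4 * s" using u by simp
      ultimately have "dist z u < 2 ^ steps * (step_ratio * s)" using z(1) by linarith
      then show "u \<in> ball z (2 ^ steps * (step_ratio * s))" by (simp only: mem_ball)
    qed
    then have "measure \<mu> (ball x (4 * s)) \<le> measure \<mu> (ball z (2 ^ steps * (step_ratio * s)))"
      by (rule measure_ball_mono)
    also have "\<dots> \<le> D ^ steps * ?m"
      using step_ratio(1) z by (intro measure_ball_double_power) auto
    finally show "content_bound * measure \<mu> (ball x (4 * s)) \<le> content_bound * (D ^ steps * ?m)"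
      using D_ge_1 by (intro mult_left_mono) (auto simp: content_bound_def)
    show "s powr p \<le> (4 * s) powr p" using z p_ge_1 by (intro powr_mono2) auto
    show "0 \<le> content_bound * (D ^ steps * ?m)" using D_ge_1 by (auto simp: content_bound_def)
    show "0 < s powr p" using z by simp
  qed
  finally have "4 * (s powr p * D ^ 2 * (\<Sum>B\<in>I. ?h B)) \<le> 
      4 * (s powr p * D ^ 2 * (content_bound * (D ^ steps * ?m) / s powr p))"
    using D_ge_1 by (intro mult_left_mono) auto
  also have "\<dots> = ?m"
    using z D_ge_1 by (simp add: content_bound_def power_add power2_eq_square field_simps)
  finally show 1: "4 * (s powr p * D ^ 2 * (\<Sum>B\<in>I. ?h B)) \<le> ?m" .
  let ?c = "\<lambda>B. cball (fst B) (2 * snd B)"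
  have Bm: "?c B \<in> sets \<mu>" for B by (simp add: sets_eq)
  have "ball z (step_ratio * s) \<subseteq> ball z (\<Lambda> * (4 * (step_ratio * s)))"
  proof -
    have "1 * (step_ratio * s) \<le> \<Lambda> * (4 * (step_ratio * s))"
      using z \<Lambda>_ge_1 step_ratio(1) mult_mono[of 1 \<Lambda> "step_ratio * s" "4 * (step_ratio * s)"] by simp
    then show ?thesis by auto
  qed
  then have sub: "ball z (step_ratio * s) \<inter> (\<Union>B\<in>BB. ?c B) \<subseteq> (\<Union>B\<in>I. ball z (step_ratio * s) \<inter> ?c B)"
    unfolding I_def by blast
  have "(\<Union>B\<in>J. ?c B) \<in> sets borel" if "finite J" for J
    using that by (intro borel_closed closed_UN) auto
  then have "ball z (step_ratio * s) \<inter> (\<Union>B\<in>J. ?c B) \<in> sets borel" if "finite J" for J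
    using that by (intro sets.Int) auto
  moreover have "(\<Union>B\<in>I. ball z (step_ratio * s) \<inter> ?c B) = ball z (step_ratio * s) \<inter> (\<Union>B\<in>I. ?c B)"
    by blast
  ultimately have "measure \<mu> (ball z (step_ratio * s) \<inter> (\<Union>B\<in>BB. ?c B)) \<le> measure \<mu> (\<Union>B\<in>I. ball z (step_ratio * s) \<inter> ?c B)"
    using BB(1) finI sub by (intro measure_mono_ball[where x = z and r = "step_ratio * s"]) auto
  also have "\<dots> \<le> (\<Sum>B\<in>I. measure \<mu> (ball z (step_ratio * s) \<inter> ?c B))"
    by (rule measure_UNION_le[OF finI]) (simp add: sets_eq)
  \<comment> \<open>Content controls measure because the radii are at most \<open>s\<close>: the
    measure of \<open>B\<close> is its content times \<open>snd B powr p\<close>.\<close>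
  also have "\<dots> \<le> (\<Sum>B\<in>I. s powr p * D ^ 2 * ?h B)"
  proof (rule sum_mono)
    fix B assume B: "B \<in> I"
    then have r: "0 < snd B" "snd B \<le> s" using BB I by (auto simp: I_def)
    have "measure \<mu> (ball z (step_ratio * s) \<inter> ?c B) \<le> measure \<mu> (ball (fst B) (2 ^ 2 * snd B))"
      by (rule measure_mono_ball[where x = "fst B" and r = "2 ^ 2 * snd B"]) (use r in auto)
    also have "\<dots> \<le> D ^ 2 * measure \<mu> (ball_set B)"
      unfolding ball_set_def by (rule measure_ball_double_power[OF r(1)])
    also have "\<dots> = snd B powr p * (D ^ 2 * ?h B)" using r by simp
    also have "\<dots> \<le> s powr p * (D ^ 2 * ?h B)"
      using r p_ge_1 by (intro mult_right_mono powr_mono2) auto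
    finally show "measure \<mu> (ball z (step_ratio * s) \<inter> ?c B) \<le> s powr p * D ^ 2 * ?h B"
      by (simp add: mult_ac)
  qed
  also have "\<dots> = s powr p * D ^ 2 * (\<Sum>B\<in>I. ?h B)" by (simp add: sum_distrib_left)
  finally show "4 * measure \<mu> (ball z (step_ratio * s) \<inter> (\<Union>B\<in>BB. ?c B)) \<le> ?m" using 1 by linarith
qed

section \<open>Tame curves along a geodesic\<close>

definition tame_const :: real where "tame_const = 4 * reach_const"

text \<open>The factor \<open>3 / 2\<close> is below 2 on purpose: when \<open>s\<close> is half the
  distance from \<open>x\<close> to \<open>y\<close>, the curve keeps a distance of at least
  \<open>s / 2\<close> from \<open>y\<close>.\<close>

definition tamely_reachable :: "'a set \<Rightarrow> 'a \<Rightarrow> real \<Rightarrow> 'a \<Rightarrow> bool" where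
  "tamely_reachable U x s v \<longleftrightarrow> (\<exists>\<gamma> L. tame_arc U tame_const x \<gamma> L \<and> \<gamma> L = v \<and>
     L \<le> reach_const * s \<and> (\<forall>t\<in>{0..L}. dist x (\<gamma> t) < 3 / 2 * s))"

text \<open>The new piece starts within \<open>step_ratio * s\<close> of \<open>z\<close> and has
  length at most \<open>reach_const * (step_ratio * s)\<close>. Together these are at most
  \<open>s / 2\<close>, so it stays in the annulus between \<open>s / 2\<close> and
  \<open>3 / 2 * s\<close> about \<open>x\<close>.\<close>

lemma tamely_reachable_extend:
  assumes v: "tamely_reachable U x s v" "dist z v < step_ratio * s"
    and z: "dist x z = s" "0 < s"
    and arc: "lip_arc U {v} w L'" "L' \<le> reach_const * (step_ratio * s)"
  shows "tamely_reachable U x ((1 + step_ratio) * s) w"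
proof -
  obtain \<gamma> L where \<gamma>: "0 \<le> L" "1-lipschitz_on {0..L} \<gamma>" "\<gamma> 0 = x" "\<gamma> L = v" "L \<le> reach_const * s"
    "\<And>t. t \<in> {0..L} \<Longrightarrow> \<gamma> t \<notin> U \<and> t \<le> tame_const * dist x (\<gamma> t) \<and> dist x (\<gamma> t) < 3 / 2 * s"
    using v(1) unfolding tamely_reachable_def tame_arc_def by blast
  obtain \<sigma> where \<sigma>: "0 \<le> L'" "1-lipschitz_on {0..L'} \<sigma>" "\<sigma> 0 = v" "\<sigma> L' = w" "\<sigma> ` {0..L'} \<inter> U = {}"
    using arc(1) unfolding lip_arc_def by auto
  define \<eta> where "\<eta> t = (if t \<le> L then \<gamma> t else \<sigma> (t - L))" for t
  have lip: "1-lipschitz_on {0..L + L'} \<eta>"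
    unfolding \<eta>_def by (rule lipschitz_on_append) (use \<gamma> \<sigma> in auto)
  have K: "65 \<le> reach_const" by (rule reach_const_ge)
  have \<delta>: "0 < step_ratio" "step_ratio * s + reach_const * (step_ratio * s) \<le> s / 2" 
    using step_ratio(1) mult_right_mono[OF step_ratio(3), of s] z by (auto simp: algebra_simps)
  have len: "L + L' \<le> reach_const * ((1 + step_ratio) * s)" using \<gamma>(5) arc(2) by (simp add: algebra_simps)
  have new: "\<sigma> t \<notin> U \<and> L + t \<le> tame_const * dist x (\<sigma> t) \<and> dist x (\<sigma> t) < 3 / 2 * s" if t: "t \<in> {0..L'}" for t
  proof -
    have "dist v (\<sigma> t) \<le> t" using lipschitz_onD[OF \<sigma>(2), of 0 t] t \<sigma>(3) by (simp add: dist_real_def)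
    then have "dist z (\<sigma> t) < step_ratio * s + t" 
      using v(2) dist_triangle[of z "\<sigma> t" v] by linarith
    then have d: "dist z (\<sigma> t) < s / 2" using t arc(2) \<delta> by auto
    have up: "dist x (\<sigma> t) < 3 / 2 * s" using d z dist_triangle[of x "\<sigma> t" z] by linarith
    have low: "s / 2 \<le> dist x (\<sigma> t)" using d z dist_triangle[of x z "\<sigma> t"] by (simp add: dist_commute)
    \<comment> \<open>A length of at most \<open>reach_const * (2 * s)\<close> against a distance of
      at least \<open>s / 2\<close> is the origin of the 4 in \<open>tame_const\<close>.\<close>
    have "L + t \<le> reach_const * ((1 + step_ratio) * s)" using len t by auto
    also have "\<dots> \<le> reach_const * (2 * s)"
      using K step_ratio(5) z by (intro mult_left_mono mult_right_mono) auto
    also have "\<dots> = tame_const * (s / 2)" by (simp add: tame_const_def)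
    also have "\<dots> \<le> tame_const * dist x (\<sigma> t)" using low K by (intro mult_left_mono) (auto simp: tame_const_def)
    finally show ?thesis using up \<sigma>(5) t by blast
  qed
  have all: "\<eta> t \<notin> U \<and> t \<le> tame_const * dist x (\<eta> t) \<and> dist x (\<eta> t) < 3 / 2 * ((1 + step_ratio) * s)" 
    if t: "t \<in> {0..L + L'}" for t
  proof -
    have "\<eta> t \<notin> U \<and> t \<le> tame_const * dist x (\<eta> t) \<and> dist x (\<eta> t) < 3 / 2 * s"
      using \<gamma>(6)[of t] new[of "t - L"] t by (auto simp: \<eta>_def)
    moreover have "0 < step_ratio * s" using \<delta>(1) z by simp
    ultimately show ?thesis by (simp add: distrib_right)
  qed
  have "\<eta> 0 = x" "\<eta> (L + L') = w" using \<gamma> \<sigma> by (auto simp: \<eta>_def)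
  then show ?thesis
    unfolding tamely_reachable_def tame_arc_def using lip len all \<gamma>(1) \<sigma>(1)
    by (intro exI[of _ \<eta>] exI[of _ "L + L'"]) auto
qed

lemma tamely_reachable_geodesic:
  assumes "0 < s" "dist x v < \<eta>" "ball x \<eta> \<inter> U = {}" "dist x v < 3 / 2 * s"
  shows "tamely_reachable U x s v"
proof -
  obtain \<sigma> where \<sigma>: "\<sigma> 0 = x" "\<sigma> (dist x v) = v"
    "\<And>s t. s \<in> {0..dist x v} \<Longrightarrow> t \<in> {0..dist x v} \<Longrightarrow> dist (\<sigma> s) (\<sigma> t) = \<bar>s - t\<bar>"
    using geodesic_isometric_path[OF geo] by blast
  have K: "65 \<le> reach_const" by (rule reach_const_ge)
  have d: "dist x (\<sigma> t) = t" if "t \<in> {0..dist x v}" for t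
    using \<sigma>(3)[of 0 t] \<sigma>(1) that by auto
  have "1-lipschitz_on {0..dist x v} \<sigma>"
    by (rule lipschitz_onI) (use \<sigma> in \<open>auto simp: dist_real_def\<close>)
  moreover have "\<sigma> t \<notin> U \<and> t \<le> tame_const * dist x (\<sigma> t) \<and> dist x (\<sigma> t) < 3 / 2 * s"
    if t: "t \<in> {0..dist x v}" for t
  proof -
    have "\<sigma> t \<in> ball x \<eta>" using d[OF t] t assms(2) by auto
    then have "\<sigma> t \<notin> U" using assms(3) by blast
    moreover have "1 * t \<le> tame_const * t" using t K by (intro mult_right_mono) (auto simp: tame_const_def)
    ultimately show ?thesis using d[OF t] t assms by auto
  qed
  moreover have "dist x v \<le> reach_const * s"
  proof -
    have "3 / 2 * s \<le> reach_const * s" using K assms(1) by (intro mult_right_mono) auto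
    then show ?thesis using assms(4) by linarith
  qed
  ultimately show ?thesis
    unfolding tamely_reachable_def tame_arc_def using \<sigma> by (intro exI[of _ \<sigma>] exI[of _ "dist x v"]) auto
qed

text \<open>One quarter of the ball is lost to unreached points and one quarter to the doubled
  balls, which leaves half for \<open>A\<close>. The doubled balls must go because
  \<open>gap_fun\<close> is known to vanish on the starting set only where all cutoffs
  vanish.\<close>

lemma tamely_reachable_step:
  assumes BB: "finite BB" "\<And>B. B \<in> BB \<Longrightarrow> 0 < snd B" 
    and x: "\<And>B. B \<in> BB \<Longrightarrow> x \<notin> ball (fst B) (4 * snd B)"
    and small: "small_content \<mu> p BB content_bound x (4 * h)"
    and z: "dist x z = s" "0 < s" "s \<le> h" "dist z z' \<le> step_ratio * s"
    and R: "R \<in> sets borel" "R \<subseteq> ball z (step_ratio * s)"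
      "4 * measure \<mu> (ball z (step_ratio * s) - R) \<le> measure \<mu> (ball z (step_ratio * s))"
      "\<And>v. v \<in> R \<Longrightarrow> tamely_reachable (\<Union>(ball_set ` BB)) x s v"
  obtains R' where "R' \<in> sets borel" "R' \<subseteq> ball z' (step_ratio * ((1 + step_ratio) * s))"
      "4 * measure \<mu> (ball z' (step_ratio * ((1 + step_ratio) * s)) - R') \<le> measure \<mu> (ball z' (step_ratio * ((1 + step_ratio) * s)))"
      "\<And>v. v \<in> R' \<Longrightarrow> tamely_reachable (\<Union>(ball_set ` BB)) x ((1 + step_ratio) * s) v"
proof -
  define r where "r = step_ratio * s"
  have r: "0 < r" using step_ratio(1) z by (simp add: r_def)
  let ?N = "\<Union>B\<in>BB. cball (fst B) (2 * snd B)" and ?U = "\<Union>(ball_set ` BB)"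
  have Nm: "?N \<in> sets borel" using BB by (intro borel_closed closed_UN) auto
  define A where "A = R - ?N"
  have Am: "A \<in> sets borel" using R Nm by (simp add: A_def)
  note near = content_near[OF BB x small z(1,2,3)]
  have "measure \<mu> (ball z r) \<le> measure \<mu> (A \<union> ((ball z r - R) \<union> (ball z r \<inter> ?N)))"
    by (rule measure_mono_ball[where x = z and r = r]) (use R Am Nm in \<open>auto simp: A_def r_def\<close>)
  also have "\<dots> \<le> measure \<mu> A + (measure \<mu> (ball z r - R) + measure \<mu> (ball z r \<inter> ?N))"
    by (intro order_trans[OF measure_Un_le add_left_mono] measure_Un_le) (use R Am Nm in \<open>auto simp: sets_eq\<close>)
  finally have A2: "measure \<mu> (ball z r) \<le> 2 * measure \<mu> A" using R(3) near(2) by (simp add: r_def)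
  have "\<exists>R'. R' \<in> sets borel \<and> R' \<subseteq> ball z' ((1 + step_ratio) * r) \<and>
    4 * measure \<mu> (ball z' ((1 + step_ratio) * r) - R') \<le> measure \<mu> (ball z' ((1 + step_ratio) * r)) \<and>
    (\<forall>v\<in>R'. \<exists>L\<le>reach_const * r. lip_arc ?U A v L)"
  proof (rule reach_step[OF BB r])
    show "dist z z' \<le> r" "r \<le> (1 + step_ratio) * r" "(1 + step_ratio) * r \<le> 2 * r"
      using z step_ratio(1,5) r by (auto simp: r_def)
    show "A \<in> sets borel" "A \<subseteq> ball z r" "A \<inter> ?N = {}" using Am R by (auto simp: A_def r_def)
    show "measure \<mu> (ball z r) \<le> 2 * measure \<mu> A" by (rule A2)
    let ?S = "\<Sum>B\<in>{B\<in>BB. cball (fst B) (2 * snd B) \<inter> ball z (\<Lambda> * (4 * r)) \<noteq> {}}. measure \<mu> (ball_set B) / snd B powr p"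
    \<comment> \<open>The height of the gap function is at most \<open>s\<close>, so the content
      estimate at scale \<open>s\<close> covers it.\<close>
    have "(reach_const * r) powr p \<le> s powr p"
    proof (rule powr_mono2)
      show "reach_const * r \<le> s"
        using mult_right_mono[OF step_ratio(4), of s] z by (simp add: r_def mult_ac)
    qed (use r reach_const_ge p_ge_1 in auto)
    then have "(reach_const * r) powr p * D ^ 2 * ?S \<le> s powr p * D ^ 2 * ?S"
      by (intro mult_right_mono sum_nonneg) auto
    moreover have "0 \<le> s powr p * D ^ 2 * ?S" by (intro mult_nonneg_nonneg sum_nonneg) auto
    ultimately show "(reach_const * r) powr p * D ^ 2 * ?S \<le> measure \<mu> (ball z r)"
      using near(1) by (simp add: r_def)
  qed
  then obtain R' where R': "R' \<in> sets borel" "R' \<subseteq> ball z' ((1 + step_ratio) * r)" 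
    "4 * measure \<mu> (ball z' ((1 + step_ratio) * r) - R') \<le> measure \<mu> (ball z' ((1 + step_ratio) * r))"
    "\<And>v. v \<in> R' \<Longrightarrow> \<exists>L\<le>reach_const * r. lip_arc ?U A v L"
    by blast
  show ?thesis
  proof (rule that[of R'])
    fix w assume "w \<in> R'"
    then obtain L where L: "L \<le> reach_const * r" "lip_arc ?U A w L" using R'(4) by blast
    then obtain v where v: "v \<in> A" "lip_arc ?U {v} w L" unfolding lip_arc_def by blast
    then show "tamely_reachable ?U x ((1 + step_ratio) * s) w"
      using L R(2,4) z
      by (intro tamely_reachable_extend[of ?U x s v z w L]) (auto simp: A_def r_def)
  qed (use R' in \<open>simp_all add: r_def mult_ac\<close>)
qed

lemma tamely_reachable_middle:
  assumes BB: "finite BB" "\<And>B. B \<in> BB \<Longrightarrow> 0 < snd B" 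
    and x: "\<And>B. B \<in> BB \<Longrightarrow> x \<notin> ball (fst B) (4 * snd B)"
    and small: "small_content \<mu> p BB content_bound x (4 * h)"
    and h: "0 < h" and \<sigma>: "\<sigma> 0 = x" "\<And>s t. s \<in> {0..h} \<Longrightarrow> t \<in> {0..h} \<Longrightarrow> dist (\<sigma> s) (\<sigma> t) = \<bar>s - t\<bar>"
  shows "\<exists>R. R \<in> sets borel \<and> R \<subseteq> ball (\<sigma> h) (step_ratio * h) \<and>
      4 * measure \<mu> (ball (\<sigma> h) (step_ratio * h) - R) \<le> measure \<mu> (ball (\<sigma> h) (step_ratio * h)) \<and>
      (\<forall>v\<in>R. tamely_reachable (\<Union>(ball_set ` BB)) x h v)"
proof -
  let ?U = "\<Union>(ball_set ` BB)" and ?q = "1 + step_ratio"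
  have q: "1 < ?q" "?q \<le> 3 / 2" using step_ratio by auto
  have "closed (\<Union>B\<in>BB. cball (fst B) (snd B))" using BB by auto
  moreover have "x \<notin> (\<Union>B\<in>BB. cball (fst B) (snd B))" using x BB(2) by fastforce
  ultimately obtain \<eta> where \<eta>: "0 < \<eta>" "ball x \<eta> \<subseteq> - (\<Union>B\<in>BB. cball (fst B) (snd B))"
    by (meson ComplI open_Compl openE)
  have "?U \<subseteq> (\<Union>B\<in>BB. cball (fst B) (snd B))" by (auto simp: ball_set_def)
  then have \<eta>U: "ball x \<eta> \<inter> ?U = {}" using \<eta>(2) by blast
  \<comment> \<open>The scales are laid out backwards from \<open>h\<close>, so that
    \<open>s N\<close> is exactly \<open>h\<close>, with \<open>N\<close> so large that
    \<open>3 / 2 * s 0\<close> is below the radius \<open>\<eta>\<close> of the free ball.\<close>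
  obtain N where N: "3 / 2 * h / \<eta> < ?q ^ N" using real_arch_pow[OF q(1)] by blast
  define s where "s n = h / ?q ^ N * ?q ^ n" for n
  have s_pos: "0 < s n" for n using h q by (simp add: s_def)
  have s_Suc: "s (Suc n) = ?q * s n" for n by (simp add: s_def)
  have s_le: "s n \<le> h" if "n \<le> N" for n
  proof -
    have "?q ^ n \<le> ?q ^ N" using q that by (intro power_increasing) auto
    then have "h / ?q ^ N * ?q ^ n \<le> h / ?q ^ N * ?q ^ N" using h q by (intro mult_left_mono) auto
    then show ?thesis using q by (simp add: s_def)
  qed
  have sN: "s N = h" using q by (simp add: s_def)
  have d: "dist x (\<sigma> t) = t" if "t \<in> {0..h}" for t using \<sigma>(2)[of 0 t] \<sigma>(1) that h by auto
  have "\<exists>R. R \<in> sets borel \<and> R \<subseteq> ball (\<sigma> (s n)) (step_ratio * s n) \<and>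
      4 * measure \<mu> (ball (\<sigma> (s n)) (step_ratio * s n) - R) \<le> measure \<mu> (ball (\<sigma> (s n)) (step_ratio * s n)) \<and>
      (\<forall>v\<in>R. tamely_reachable ?U x (s n) v)" if "n \<le> N" for n
    using that
  proof (induction n)
    case 0
    have "3 / 2 * s 0 < \<eta>" using N \<eta>(1) q by (simp add: s_def field_simps)
    moreover have "dist x v < 3 / 2 * s 0" if "v \<in> ball (\<sigma> (s 0)) (step_ratio * s 0)" for v
    proof -
      have "dist x v < s 0 + step_ratio * s 0"
        using dist_triangle[of x v "\<sigma> (s 0)"] d[of "s 0"] s_pos[of 0] s_le[of 0] that by auto
      also have "\<dots> = ?q * s 0" by (simp add: distrib_right)
      also have "\<dots> \<le> 3 / 2 * s 0" using q s_pos[of 0] by (intro mult_right_mono) auto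
      finally show ?thesis .
    qed
    ultimately have "tamely_reachable ?U x (s 0) v" if "v \<in> ball (\<sigma> (s 0)) (step_ratio * s 0)" for v
      using that by (intro tamely_reachable_geodesic[OF s_pos _ \<eta>U]) force+
    then show ?case by (intro exI[of _ "ball (\<sigma> (s 0)) (step_ratio * s 0)"]) auto
  next
    case (Suc n)
    then have n: "n \<le> N" by simp
    obtain R where R: "R \<in> sets borel" "R \<subseteq> ball (\<sigma> (s n)) (step_ratio * s n)"
      "4 * measure \<mu> (ball (\<sigma> (s n)) (step_ratio * s n) - R) \<le> measure \<mu> (ball (\<sigma> (s n)) (step_ratio * s n))"
      "\<And>v. v \<in> R \<Longrightarrow> tamely_reachable ?U x (s n) v"
      using Suc.IH[OF n] by blast
    have sn: "s n \<in> {0..h}" "s (Suc n) \<in> {0..h}"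
      using s_pos[of n] s_pos[of "Suc n"] s_le[OF n] s_le[OF Suc.prems] by auto
    \<comment> \<open>Consecutive centres are exactly one radius of the current ball apart, the
      largest shift that \<open>reach_step\<close> permits.\<close>
    have "dist (\<sigma> (s n)) (\<sigma> (s (Suc n))) = \<bar>s n - s (Suc n)\<bar>" by (rule \<sigma>(2)[OF sn])
    also have "\<dots> = step_ratio * s n" 
      using step_ratio(1) s_pos[of n] by (simp add: s_Suc distrib_right)
    finally have dz: "dist (\<sigma> (s n)) (\<sigma> (s (Suc n))) \<le> step_ratio * s n" by simp
    show ?case
      by (rule tamely_reachable_step[OF BB x small d[OF sn(1)] s_pos s_le[OF n] dz R])
         (use s_Suc in auto)
  qed
  from this[of N] sN show ?thesis by simp
qed

text \<open>The half started at \<open>x\<close> stays within \<open>3 / 2 * h\<close> of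
  \<open>x\<close>, hence at least \<open>h / 2\<close> from \<open>y\<close>, and symmetrically.
  There the condition at the far endpoint follows from the total length alone, which is at most
  \<open>tame_const * (h / 2)\<close>. The bound \<open>7 / 4 * d\<close> is
  \<open>d + 3 / 2 * h\<close>.\<close>

lemma uniform_arc:
  assumes BB: "finite BB" "\<And>B. B \<in> BB \<Longrightarrow> 0 < snd B" 
    and xy: "\<And>B z. B \<in> BB \<Longrightarrow> z \<in> {x, y} \<Longrightarrow> z \<notin> ball (fst B) (4 * snd B)"
    and small: "\<And>z. z \<in> {x, y} \<Longrightarrow> small_content \<mu> p BB content_bound z (2 * dist x y)"
    and d: "d = dist x y" "0 < d"
  obtains \<gamma> L where "0 \<le> L" "1-lipschitz_on {0..L} \<gamma>" "\<gamma> 0 = x" "\<gamma> L = y"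
    "\<And>t. t \<in> {0..L} \<Longrightarrow> \<gamma> t \<notin> \<Union>(ball_set ` BB) \<and> t \<le> tame_const * dist x (\<gamma> t) \<and>
       L - t \<le> tame_const * dist y (\<gamma> t) \<and> dist x (\<gamma> t) \<le> 7 / 4 * d"
proof -
  let ?U = "\<Union>(ball_set ` BB)"
  define h where "h = d / 2"
  have h: "0 < h" "4 * h = 2 * dist x y" "d = 2 * h" using d by (auto simp: h_def)
  obtain \<sigma> where \<sigma>: "\<sigma> 0 = x" "\<sigma> d = y"
    "\<And>s t. s \<in> {0..d} \<Longrightarrow> t \<in> {0..d} \<Longrightarrow> dist (\<sigma> s) (\<sigma> t) = \<bar>s - t\<bar>"
    using geodesic_isometric_path[OF geo, of x y] d(1) by blast
  let ?B = "ball (\<sigma> h) (step_ratio * h)"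
  have middle: "\<exists>R. R \<in> sets borel \<and> R \<subseteq> ball (\<tau> h) (step_ratio * h) \<and>
      4 * measure \<mu> (ball (\<tau> h) (step_ratio * h) - R) \<le> measure \<mu> (ball (\<tau> h) (step_ratio * h)) \<and>
      (\<forall>v\<in>R. tamely_reachable ?U z h v)"
    if "z \<in> {x, y}" "\<tau> 0 = z" "\<And>s t. s \<in> {0..h} \<Longrightarrow> t \<in> {0..h} \<Longrightarrow> dist (\<tau> s) (\<tau> t) = \<bar>s - t\<bar>" for z \<tau>
  proof (rule tamely_reachable_middle[OF BB])
    show "z \<notin> ball (fst B) (4 * snd B)" if "B \<in> BB" for B by (rule xy[OF that \<open>z \<in> {x, y}\<close>])
    show "small_content \<mu> p BB content_bound z (4 * h)" unfolding h(2) by (rule small[OF that(1)])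
  qed (use that h(1) in auto)
  obtain R where R: "R \<in> sets borel" "R \<subseteq> ?B" "4 * measure \<mu> (?B - R) \<le> measure \<mu> ?B"
      "\<And>v. v \<in> R \<Longrightarrow> tamely_reachable ?U x h v"
  proof -
    have "dist (\<sigma> s) (\<sigma> t) = \<bar>s - t\<bar>" if "s \<in> {0..h}" "t \<in> {0..h}" for s t
      using that h by (intro \<sigma>(3)) auto
    from middle[of x \<sigma>, OF _ \<sigma>(1) this] show ?thesis using that by auto
  qed
  obtain S where S: "S \<in> sets borel" "S \<subseteq> ?B" "4 * measure \<mu> (?B - S) \<le> measure \<mu> ?B"
      "\<And>v. v \<in> S \<Longrightarrow> tamely_reachable ?U y h v"
  proof -
    have "dist (\<sigma> (d - s)) (\<sigma> (d - t)) = \<bar>s - t\<bar>" if "s \<in> {0..h}" "t \<in> {0..h}" for s t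
      using \<sigma>(3)[of "d - s" "d - t"] that h by (auto simp: abs_minus_commute)
    moreover have "d - h = h" using h by simp
    ultimately show ?thesis using middle[of y "\<lambda>t. \<sigma> (d - t)"] \<sigma>(2) that by auto
  qed
  have "R \<inter> S \<noteq> {}"
  proof
    assume "R \<inter> S = {}"
    then have "measure \<mu> ?B \<le> measure \<mu> ((?B - R) \<union> (?B - S))"
      by (intro measure_mono_ball[where x = "\<sigma> h" and r = "step_ratio * h"]) (use R S in auto)
    also have "\<dots> \<le> measure \<mu> (?B - R) + measure \<mu> (?B - S)"
      by (rule measure_Un_le) (use R S in \<open>auto simp: sets_eq\<close>)
    finally show False using R(3) S(3) measure_ball_pos[of "step_ratio * h" "\<sigma> h"] h step_ratio(1) by simp
  qed
  then obtain v where v: "tamely_reachable ?U x h v" "tamely_reachable ?U y h v" using R S by blast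
  obtain \<alpha> L where \<alpha>: "0 \<le> L" "1-lipschitz_on {0..L} \<alpha>" "\<alpha> 0 = x" "\<alpha> L = v" "L \<le> reach_const * h"
    "\<And>t. t \<in> {0..L} \<Longrightarrow> \<alpha> t \<notin> ?U \<and> t \<le> tame_const * dist x (\<alpha> t) \<and> dist x (\<alpha> t) < 3 / 2 * h"
    using v(1) unfolding tamely_reachable_def tame_arc_def by blast
  obtain \<beta> L' where \<beta>: "0 \<le> L'" "1-lipschitz_on {0..L'} \<beta>" "\<beta> 0 = y" "\<beta> L' = v" "L' \<le> reach_const * h"
    "\<And>t. t \<in> {0..L'} \<Longrightarrow> \<beta> t \<notin> ?U \<and> t \<le> tame_const * dist y (\<beta> t) \<and> dist y (\<beta> t) < 3 / 2 * h"
    using v(2) unfolding tamely_reachable_def tame_arc_def by blast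
  define \<gamma> where "\<gamma> t = (if t \<le> L then \<alpha> t else \<beta> (L' - (t - L)))" for t
  have "1-lipschitz_on {0..L'} (\<lambda>t. \<beta> (L' - t))"
  proof (rule lipschitz_onI)
    show "dist (\<beta> (L' - s)) (\<beta> (L' - t)) \<le> 1 * dist s t" if "s \<in> {0..L'}" "t \<in> {0..L'}" for s t
      using lipschitz_onD[OF \<beta>(2), of "L' - s" "L' - t"] that by (simp add: dist_real_def abs_minus_commute)
  qed simp
  then have lip: "1-lipschitz_on {0..L + L'} \<gamma>"
    unfolding \<gamma>_def by (rule lipschitz_on_append[OF \<alpha>(2,1)]) (use \<alpha> \<beta> in auto)
  have K: "65 \<le> reach_const" by (rule reach_const_ge)
  have half: "t \<le> tame_const * a" if "t \<le> L + L'" "h / 2 \<le> a" for t a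
  proof -
    have "tame_const * (h / 2) = reach_const * h + reach_const * h" by (simp add: tame_const_def)
    then have "t \<le> tame_const * (h / 2)" using that(1) \<alpha>(5) \<beta>(5) by linarith
    also have "\<dots> \<le> tame_const * a" using that(2) K by (intro mult_left_mono) (auto simp: tame_const_def)
    finally show ?thesis .
  qed
  have tri: "d \<le> dist x u + dist y u" "dist x u \<le> d + dist y u" for u
    using dist_triangle[of x y u] dist_triangle[of x u y] d by (auto simp: dist_commute)
  show ?thesis
  proof (rule that[of "L + L'" \<gamma>])
    show "0 \<le> L + L'" "1-lipschitz_on {0..L + L'} \<gamma>" "\<gamma> 0 = x" "\<gamma> (L + L') = y"
      using \<alpha> \<beta> lip by (auto simp: \<gamma>_def)
    fix t assume t: "t \<in> {0..L + L'}"
    show "\<gamma> t \<notin> ?U \<and> t \<le> tame_const * dist x (\<gamma> t) \<and>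
       L + L' - t \<le> tame_const * dist y (\<gamma> t) \<and> dist x (\<gamma> t) \<le> 7 / 4 * d"
    proof (cases "t \<le> L")
      case True
      then have *: "\<gamma> t \<notin> ?U \<and> t \<le> tame_const * dist x (\<gamma> t) \<and> dist x (\<gamma> t) < 3 / 2 * h"
        using \<alpha>(6)[of t] t by (auto simp: \<gamma>_def)
      then show ?thesis using half[of "L + L' - t" "dist y (\<gamma> t)"] tri[of "\<gamma> t"] h t by auto
    next
      case False
      then have *: "\<gamma> t \<notin> ?U \<and> L + L' - t \<le> tame_const * dist y (\<gamma> t) \<and> dist y (\<gamma> t) < 3 / 2 * h"
        using \<beta>(6)[of "L' - (t - L)"] t by (auto simp: \<gamma>_def algebra_simps)
      then show ?thesis using half[of t "dist x (\<gamma> t)"] tri[of "\<gamma> t"] h t by auto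
    qed
  qed
qed

end

section \<open>Countable families by compactness\<close>

context poincare_space
begin

text \<open>Doubling and completeness make the space proper. The \<open>e / 2\<close>-balls about an
  \<open>e\<close>-separated set are disjoint, lie in \<open>ball x (2 * T)\<close> and each have a
  fixed share of the measure of \<open>ball x T\<close>, which bounds their number. A separated set
  of greatest cardinality is then an \<open>e\<close>-net.\<close>

lemma compact_cball: "compact (cball (x :: 'a) r)"
  unfolding compact_eq_totally_bounded
proof (intro conjI allI impI)
  show "complete (cball x r)" by (simp add: complete_eq_closed)
  fix e :: real assume e: "0 < e"
  define P where "P k \<longleftrightarrow> finite k \<and> k \<subseteq> cball x r \<and> (\<forall>u\<in>k. \<forall>v\<in>k. u \<noteq> v \<longrightarrow> e \<le> dist u v)" for k
  \<comment> \<open>The real \<open>r\<close> is arbitrary; adding \<open>e\<close> makes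
    \<open>T\<close> positive and keeps the \<open>e / 2\<close>-balls inside
    \<open>ball x (2 * T)\<close>.\<close>
  define T where "T = \<bar>r\<bar> + e"
  have T: "0 < T" "r < T" using e by (auto simp: T_def)
  obtain n where n: "4 * T / e < 2 ^ n" using real_arch_pow[of 2 "4 * T / e"] by auto
  let ?m = "measure \<mu> (ball x T)" and ?m' = "measure \<mu> (ball x (2 * T))"
  have m: "0 < ?m" by (rule measure_ball_pos[OF T(1)])
  have D: "0 < D ^ n" using D_ge_1 by simp
  have bound: "real (card k) \<le> D ^ n * ?m' / ?m" if k: "P k" for k
  proof -
    have fin: "finite k" using k by (simp add: P_def)
    have "?m / D ^ n \<le> measure \<mu> (ball u (e / 2))" if u: "u \<in> k" for u
    proof -
      have xu: "dist x u \<le> r" using k u by (auto simp: P_def)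
      have "ball x T \<subseteq> ball u (2 ^ n * (e / 2))"
      proof
        fix v assume v: "v \<in> ball x T"
        have "dist u v \<le> dist x u + dist x v" by (metis dist_commute dist_triangle)
        moreover have "2 * T < 2 ^ n * (e / 2)" using n e by (simp add: field_simps)
        moreover have "dist x v < T" using v by simp
        ultimately have "dist u v < 2 ^ n * (e / 2)" using xu T by linarith
        then show "v \<in> ball u (2 ^ n * (e / 2))" by (simp only: mem_ball)
      qed
      from measure_ball_mono[OF this] measure_ball_double_power[of "e / 2" u n] e
      have "?m \<le> D ^ n * measure \<mu> (ball u (e / 2))" by simp
      then show ?thesis using D by (simp add: field_simps)
    qed
    then have "(\<Sum>u\<in>k. ?m / D ^ n) \<le> (\<Sum>u\<in>k. measure \<mu> (ball u (e / 2)))" by (rule sum_mono)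
    also have "\<dots> = measure \<mu> (\<Union>u\<in>k. ball u (e / 2))"
    proof (rule measure_finite_Union[symmetric, OF fin])
      show "disjoint_family_on (\<lambda>u. ball u (e / 2)) k"
        unfolding disjoint_family_on_def
      proof (intro ballI impI)
        fix u v assume uv: "u \<in> k" "v \<in> k" "u \<noteq> v"
        then have "e \<le> dist u v" using k by (simp add: P_def)
        then have "w \<in> ball u (e / 2) \<Longrightarrow> w \<notin> ball v (e / 2)" for w
          using dist_triangle[of u v w] by (simp add: dist_commute)
        then show "ball u (e / 2) \<inter> ball v (e / 2) = {}" by blast
      qed
      show "emeasure \<mu> (ball u (e / 2)) \<noteq> \<infinity>" for u
        using emeasure_ball_finite[of u "e / 2"] by simp
    qed (auto simp: sets_eq)
    also have "\<dots> \<le> ?m'"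
    proof (rule measure_mono_ball[where x = x and r = "2 * T"])
      show "(\<Union>u\<in>k. ball u (e / 2)) \<subseteq> ball x (2 * T)"
      proof (rule UN_least, rule subsetI)
        fix u w assume "u \<in> k" "w \<in> ball u (e / 2)"
        then have "dist x u \<le> r" "dist u w < e / 2" using k by (auto simp: P_def)
        then show "w \<in> ball x (2 * T)" using dist_triangle[of x w u] e T by (simp add: T_def)
      qed
    qed (auto intro!: borel_open)
    finally have "real (card k) * (?m / D ^ n) \<le> ?m'" by simp
    then show ?thesis using m D by (simp add: field_simps)
  qed
  have "P {}" by (simp add: P_def)
  moreover have "\<forall>k. P k \<longrightarrow> card k < Suc (nat \<lceil>D ^ n * ?m' / ?m\<rceil>)"
    by (intro allI impI) (drule bound, linarith)
  ultimately have "\<exists>k. P k \<and> (\<forall>k'. P k' \<longrightarrow> card k' \<le> card k)"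
    by (rule ex_has_greatest_nat)
  then obtain k where k: "P k" "\<And>k'. P k' \<Longrightarrow> card k' \<le> card k" by auto
  have "cball x r \<subseteq> (\<Union>u\<in>k. ball u e)"
  proof (rule subsetI, rule ccontr)
    fix v assume v: "v \<in> cball x r" "v \<notin> (\<Union>u\<in>k. ball u e)"
    then have far: "e \<le> dist u v" if "u \<in> k" for u using that by auto
    have "v \<notin> k" using far[of v] e by auto
    moreover have "P (insert v k)"
      using k(1) v(1) far unfolding P_def by (auto simp: dist_commute)
    ultimately show False using k(2)[of "insert v k"] k(1) by (simp add: P_def)
  qed
  then show "\<exists>k. finite k \<and> cball x r \<subseteq> (\<Union>u\<in>k. ball u e)" using k(1) by (auto simp: P_def)
qed

text \<open>These conditions constrain only finitely many values of the curve at a time, so they are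
  closed in the product topology, and Tychonoff's theorem provides a curve satisfying all of them.
  Dividing by \<open>t\<close> or \<open>1 - t\<close> bounds the length of the curve before and after \<open>t\<close>.\<close>

definition uniform_curves :: "real \<Rightarrow> 'a \<Rightarrow> 'a \<Rightarrow> (real \<Rightarrow> 'a) set" where
  "uniform_curves \<kappa> x y = {\<phi>. \<phi> 0 = x \<and> \<phi> 1 = y \<and>
     (\<forall>a b t. 0 \<le> a \<longrightarrow> a \<le> b \<longrightarrow> b \<le> t \<longrightarrow> t \<le> 1 \<longrightarrow>
        t * dist (\<phi> a) (\<phi> b) \<le> (b - a) * (\<kappa> * dist x (\<phi> t))) \<and>
     (\<forall>a b t. 0 \<le> t \<longrightarrow> t \<le> a \<longrightarrow> a \<le> b \<longrightarrow> b \<le> 1 \<longrightarrow>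
        (1 - t) * dist (\<phi> a) (\<phi> b) \<le> (b - a) * (\<kappa> * dist y (\<phi> t)))}"

lemma closed_uniform_curves: "closed (uniform_curves \<kappa> x y)"
  unfolding uniform_curves_def
  by (intro closed_Collect_conj closed_Collect_all closed_Collect_imp closed_Collect_eq closed_Collect_le
      open_Collect_const continuous_intros continuous_on_product_coordinates)

text \<open>Pointwise limits suffice: the Lipschitz bounds are among the closed conditions, and
  avoiding an open ball at each time is closed too. Each finite subfamily supplies one curve for the
  finite intersection property.\<close>

lemma uniform_curves_exist:
  assumes BB: "\<And>B. B \<in> \<B> \<Longrightarrow> 0 < snd B"
    and xy: "\<And>B z. B \<in> \<B> \<Longrightarrow> z \<in> {x, y} \<Longrightarrow> z \<notin> ball (fst B) (4 * snd B)"
    and small: "\<And>BB z. finite BB \<Longrightarrow> BB \<subseteq> \<B> \<Longrightarrow> z \<in> {x, y} \<Longrightarrow>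
      small_content \<mu> p BB content_bound z (2 * dist x y)"
    and d: "x \<noteq> y"
  obtains \<phi> where "\<phi> \<in> uniform_curves tame_const x y" "\<And>t. dist x (\<phi> t) \<le> 7 / 4 * dist x y"
    "\<And>t. t \<in> {0..1} \<Longrightarrow> \<phi> t \<notin> \<Union>(ball_set ` \<B>)"
proof -
  let ?d = "dist x y"
  \<comment> \<open>The product runs over all reals, so the curves put into it below are frozen at
    their endpoints outside \<open>{0..1}\<close>.\<close>
  define K where "K = PiE UNIV (\<lambda>_ :: real. cball x (7 / 4 * ?d))"
  define T where "T B = {\<phi> :: real \<Rightarrow> 'a. \<forall>t\<in>{0..1}. \<phi> t \<in> - ball_set B}" for B
  have "compactin (product_topology (\<lambda>_. euclidean) UNIV) K"
    unfolding K_def compactin_PiE using compact_cball by auto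
  then have "compact K" by (simp add: euclidean_product_topology)
  then have comp: "compact (K \<inter> uniform_curves tame_const x y)"
    by (rule compact_Int_closed) (rule closed_uniform_curves)
  have closed: "closed (T B)" for B
  proof -
    have "T B = (\<Inter>t\<in>{0..1}. (\<lambda>\<phi>. \<phi> t) -` (- ball_set B))" by (auto simp: T_def)
    moreover have "closed ((\<lambda>\<phi> :: real \<Rightarrow> 'a. \<phi> t) -` (- ball_set B))" for t
      by (rule closed_vimage) (auto simp: ball_set_def)
    ultimately show ?thesis by auto
  qed
  have "(K \<inter> uniform_curves tame_const x y) \<inter> (\<Inter>B\<in>\<B>. T B) \<noteq> {}"
  proof (rule compact_imp_fip_image[OF comp closed])
    fix BB assume BB': "finite BB" "BB \<subseteq> \<B>"
    obtain \<gamma> L where \<gamma>: "0 \<le> L" "1-lipschitz_on {0..L} \<gamma>" "\<gamma> 0 = x" "\<gamma> L = y"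
      "\<And>t. t \<in> {0..L} \<Longrightarrow> \<gamma> t \<notin> \<Union>(ball_set ` BB) \<and> t \<le> tame_const * dist x (\<gamma> t) \<and>
         L - t \<le> tame_const * dist y (\<gamma> t) \<and> dist x (\<gamma> t) \<le> 7 / 4 * ?d"
      by (rule uniform_arc[of BB x y ?d]) (use BB xy BB' small d in auto)
    define \<phi> where "\<phi> t = \<gamma> (L * max 0 (min 1 t))" for t
    have \<phi>: "\<phi> t = \<gamma> (L * t)" if "0 \<le> t" "t \<le> 1" for t using that by (simp add: \<phi>_def)
    have in_L: "L * t \<in> {0..L}" if "0 \<le> t" "t \<le> 1" for t 
      using that \<gamma>(1) by (auto intro: mult_left_le)
    have clamp: "L * max 0 (min 1 t) \<in> {0..L}" for t by (rule in_L) auto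
    have lip: "dist (\<phi> a) (\<phi> b) \<le> L * (b - a)" if "0 \<le> a" "a \<le> b" "b \<le> 1" for a b
    proof -
      have "dist (\<gamma> (L * a)) (\<gamma> (L * b)) \<le> 1 * dist (L * a) (L * b)"
        by (rule lipschitz_onD[OF \<gamma>(2)]) (use in_L that in auto)
      also have "\<dots> = L * (b - a)"
        using that \<gamma>(1) by (simp add: dist_real_def right_diff_distrib[symmetric] abs_mult)
      finally show ?thesis using \<phi> that by simp
    qed
    have "\<phi> \<in> uniform_curves tame_const x y"
      unfolding uniform_curves_def
    proof (intro CollectI conjI allI impI)
      show "\<phi> 0 = x" "\<phi> 1 = y" using \<gamma> by (auto simp: \<phi>_def)
      fix a b t :: real
      {
        assume t: "0 \<le> a" "a \<le> b" "b \<le> t" "t \<le> 1"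
        have "t * dist (\<phi> a) (\<phi> b) \<le> t * (L * (b - a))" using lip t by (intro mult_left_mono) auto
        also have "\<dots> = (b - a) * (L * t)" by simp
        also have "\<dots> \<le> (b - a) * (tame_const * dist x (\<phi> t))"
          using \<gamma>(5)[OF in_L[of t]] \<phi>[of t] t by (intro mult_left_mono) auto
        finally show "t * dist (\<phi> a) (\<phi> b) \<le> (b - a) * (tame_const * dist x (\<phi> t))" .
      next
        assume t: "0 \<le> t" "t \<le> a" "a \<le> b" "b \<le> 1"
        have "(1 - t) * dist (\<phi> a) (\<phi> b) \<le> (1 - t) * (L * (b - a))" using lip t by (intro mult_left_mono) auto
        also have "\<dots> = (b - a) * (L - L * t)" by (simp add: algebra_simps)
        also have "\<dots> \<le> (b - a) * (tame_const * dist y (\<phi> t))"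
          using \<gamma>(5)[OF in_L[of t]] \<phi>[of t] t by (intro mult_left_mono) auto
        finally show "(1 - t) * dist (\<phi> a) (\<phi> b) \<le> (b - a) * (tame_const * dist y (\<phi> t))" .
      }
    qed
    moreover have "\<phi> \<in> K" unfolding K_def \<phi>_def using \<gamma>(5)[OF clamp] by auto
    moreover have "\<phi> \<in> T B" if "B \<in> BB" for B
      unfolding T_def \<phi>_def using \<gamma>(5)[OF clamp] that by blast
    ultimately show "(K \<inter> uniform_curves tame_const x y) \<inter> (\<Inter>B\<in>BB. T B) \<noteq> {}" by blast
  qed
  then obtain \<phi> where \<phi>: "\<phi> \<in> K" "\<phi> \<in> uniform_curves tame_const x y" "\<And>B. B \<in> \<B> \<Longrightarrow> \<phi> \<in> T B" by blast
  then show ?thesis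
    by (intro that[of \<phi>]) (auto simp: K_def T_def PiE_iff)
qed

lemma uniform_curve_properties:
  assumes \<phi>: "\<phi> \<in> uniform_curves \<kappa> x y" and \<kappa>: "0 \<le> \<kappa>"
  shows "rectifiable_path \<phi>" "curve_length \<phi> 0 1 \<le> ennreal (\<kappa> * dist x y)"
    and "t \<in> {0..1} \<Longrightarrow> curve_length \<phi> 0 t \<le> ennreal (\<kappa> * dist (\<phi> t) x)"
    and "t \<in> {0..1} \<Longrightarrow> curve_length \<phi> t 1 \<le> ennreal (\<kappa> * dist (\<phi> t) y)"
proof -
  have ends: "\<phi> 0 = x" "\<phi> 1 = y" using \<phi> by (auto simp: uniform_curves_def)
  have before: "t * dist (\<phi> a) (\<phi> b) \<le> (b - a) * (\<kappa> * dist x (\<phi> t))"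
    if "0 \<le> a" "a \<le> b" "b \<le> t" "t \<le> 1" for a b t
    using \<phi> that unfolding uniform_curves_def by blast
  have after: "(1 - t) * dist (\<phi> a) (\<phi> b) \<le> (b - a) * (\<kappa> * dist y (\<phi> t))"
    if "0 \<le> t" "t \<le> a" "a \<le> b" "b \<le> 1" for a b t
    using \<phi> that unfolding uniform_curves_def by blast
  show left: "curve_length \<phi> 0 t \<le> ennreal (\<kappa> * dist (\<phi> t) x)" if t: "t \<in> {0..1}" for t
  proof (cases "t = 0")
    case False
    have "curve_length \<phi> 0 t \<le> ennreal (\<kappa> * dist x (\<phi> t) / t * (t - 0))"
    proof (rule curve_length_lipschitz)
      fix a b assume "0 \<le> a" "a \<le> b" "b \<le> t"
      then show "dist (\<phi> a) (\<phi> b) \<le> \<kappa> * dist x (\<phi> t) / t * (b - a)"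
        using before[of a b t] t False by (simp add: field_simps)
    qed
    then show ?thesis using False by (simp add: dist_commute)
  qed (simp add: curve_length_refl)
  show "curve_length \<phi> t 1 \<le> ennreal (\<kappa> * dist (\<phi> t) y)" if t: "t \<in> {0..1}" for t
  proof (cases "t = 1")
    case False
    have "curve_length \<phi> t 1 \<le> ennreal (\<kappa> * dist y (\<phi> t) / (1 - t) * (1 - t))"
    proof (rule curve_length_lipschitz)
      fix a b assume "t \<le> a" "a \<le> b" "b \<le> 1"
      then show "dist (\<phi> a) (\<phi> b) \<le> \<kappa> * dist y (\<phi> t) / (1 - t) * (b - a)"
        using after[of t a b] t False by (simp add: field_simps)
    qed
    then show ?thesis using False by (simp add: dist_commute)
  qed (simp add: curve_length_refl)
  show len: "curve_length \<phi> 0 1 \<le> ennreal (\<kappa> * dist x y)"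
    using left[of 1] ends by (simp add: dist_commute)
  \<comment> \<open>The first family of conditions at \<open>t = 1\<close>, where
    \<open>\<phi> 1 = y\<close>, is a Lipschitz bound on the whole interval.\<close>
  have "(\<kappa> * dist x y)-lipschitz_on {0..1} \<phi>"
  proof (rule lipschitz_onI)
    fix a b :: real assume "a \<in> {0..1}" "b \<in> {0..1}"
    then show "dist (\<phi> a) (\<phi> b) \<le> \<kappa> * dist x y * dist a b"
      using before[of a b 1] before[of b a 1] ends
      by (cases "a \<le> b") (auto simp: dist_real_def dist_commute mult_ac)
  qed (use \<kappa> in simp)
  then have "path \<phi>" unfolding path_def by (rule lipschitz_on_continuous_on)
  moreover have "curve_length \<phi> 0 1 < \<infinity>" using len by (rule le_less_trans) simp
  ultimately show "rectifiable_path \<phi>" by (simp add: rectifiable_path_def)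
qed

text \<open>Nonnegative extended reals are always summable, so a finite subfamily has the smaller
  sum. Since the radii are positive and balls have finite measure, the resulting inequality is one
  between real numbers.\<close>

lemma small_contentI:
  assumes BB: "finite BB" "BB \<subseteq> \<B>" and pos: "\<And>B. B \<in> \<B> \<Longrightarrow> 0 < snd B" and \<epsilon>: "0 \<le> \<epsilon>"
    and sum: "\<And>r. r \<in> {0<..d} \<Longrightarrow> (\<Sum>\<^sub>\<infinity>B\<in>{B\<in>\<B>. ball_set B \<inter> ball z r \<noteq> {}}. ball_content p \<mu> B)
         \<le> ennreal \<epsilon> * ball_content p \<mu> (z, r)"
  shows "small_content \<mu> p BB \<epsilon> z d"
  unfolding small_content_def
proof
  fix r assume r: "r \<in> {0<..d}"
  have content: "ball_content p \<mu> B = ennreal (measure \<mu> (ball_set B) / snd B powr p)" if "0 < snd B" for B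
    using that by (simp add: ball_content_def ball_set_def emeasure_ball divide_ennreal)
  let ?I = "{B\<in>BB. ball_set B \<inter> ball z r \<noteq> {}}"
  have "ennreal (\<Sum>B\<in>?I. measure \<mu> (ball_set B) / snd B powr p) = (\<Sum>B\<in>?I. ball_content p \<mu> B)"
  proof (subst sum_ennreal[symmetric])
    show "(\<Sum>B\<in>?I. ennreal (measure \<mu> (ball_set B) / snd B powr p)) = (\<Sum>B\<in>?I. ball_content p \<mu> B)"
      by (intro sum.cong refl content[symmetric] pos) (use BB(2) in auto)
  qed simp
  also have "\<dots> = (\<Sum>\<^sub>\<infinity>B\<in>?I. ball_content p \<mu> B)" using BB by simp
  also have "\<dots> \<le> (\<Sum>\<^sub>\<infinity>B\<in>{B\<in>\<B>. ball_set B \<inter> ball z r \<noteq> {}}. ball_content p \<mu> B)"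
    by (rule infsum_mono_neutral) (use BB in \<open>auto intro!: nonneg_summable_on_complete\<close>)
  also have "\<dots> \<le> ennreal \<epsilon> * ball_content p \<mu> (z, r)" by (rule sum[OF r])
  also have "\<dots> = ennreal (\<epsilon> * measure \<mu> (ball z r) / r powr p)"
    using content[of "(z, r)"] r \<epsilon> by (simp add: ball_set_def ennreal_mult[symmetric])
  finally show "(\<Sum>B\<in>?I. measure \<mu> (ball_set B) / snd B powr p) \<le> \<epsilon> * measure \<mu> (ball z r) / r powr p"
    by (subst (asm) ennreal_le_iff) (use \<epsilon> in auto)
qed

end

theorem lemma3p4:
  fixes \<mu> :: "'a::polish_space measure" and p :: real
  assumes "radon_measure \<mu>"
    and "geodesic (UNIV :: 'a set)"
    and "doubling_measure \<mu>"
    and "1 \<le> p"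
    and "supports_Poincare p \<mu>"
  shows "\<exists>C1 > 0. \<exists>\<epsilon>0 > 0. \<forall>(x :: 'a) (y :: 'a) (\<B> :: ('a \<times> real) set).
    x \<noteq> y \<longrightarrow>
    countable \<B> \<longrightarrow>
    (\<forall>B\<in>\<B>. 0 < snd B) \<longrightarrow>
    {x, y} \<inter> (\<Union>B\<in>\<B>. ball_set (scale_ball 4 B)) = {} \<longrightarrow>
    (\<forall>r\<in>{0<..4 * dist x y}. \<forall>z\<in>{x, y}.
       (\<Sum>\<^sub>\<infinity>B\<in>{B\<in>\<B>. ball_set B \<inter> ball z r \<noteq> {}}. ball_content p \<mu> B)
         \<le> ennreal \<epsilon>0 * ball_content p \<mu> (z, r)) \<longrightarrow>
    (\<exists>\<gamma>. rectifiable_path \<gamma> \<and> \<gamma> 0 = x \<and> \<gamma> 1 = y \<and>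
       path_image \<gamma> \<inter> (\<Union>B\<in>\<B>. ball_set B) = {} \<and>
       path_image \<gamma> \<subseteq> ball x (2 * dist x y) \<and>
       curve_length \<gamma> 0 1 \<le> ennreal (C1 * dist x y) \<and>
       (\<forall>t\<in>{0..1}.
          curve_length \<gamma> 0 t \<le> ennreal (C1 * dist (\<gamma> t) x) \<and>
          curve_length \<gamma> t 1 \<le> ennreal (C1 * dist (\<gamma> t) y)))"
proof -
  obtain D where D: "1 \<le> D" "\<forall>x. \<forall>r>0.
        0 < emeasure \<mu> (ball x (2 * r)) \<and>
        emeasure \<mu> (ball x (2 * r)) \<le> ennreal D * emeasure \<mu> (ball x r) \<and>
        ennreal D * emeasure \<mu> (ball x r) < \<infinity>"
    using assms(3) unfolding doubling_measure_def by blast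
  obtain C \<Lambda> where C: "1 \<le> C" "1 \<le> \<Lambda>" "\<forall>f\<in>L1_loc \<mu>. \<forall>g. upper_gradient g f \<longrightarrow> (\<forall>x. \<forall>r>0.
        (\<integral>\<^sup>+z\<in>ball x r. ennreal \<bar>f z - average \<mu> (ball x r) f\<bar> \<partial>completion \<mu>)
            / emeasure \<mu> (ball x r)
        \<le> ennreal (C * r) *
          ennreal_powr ((\<integral>\<^sup>+z\<in>ball x (\<Lambda> * r). ennreal_powr (g z) p \<partial>\<mu>)
            / emeasure \<mu> (ball x (\<Lambda> * r))) (1 / p))"
    using assms(5) unfolding supports_Poincare_def by blast
  interpret poincare_space \<mu> p D C \<Lambda>
  proof
    show "sets \<mu> = sets borel" using assms(1) by (simp add: radon_measure_def)
  qed (use assms(2,4) D C in blast)+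
  have \<kappa>: "0 < tame_const" using reach_const_ge by (simp add: tame_const_def)
  have \<epsilon>: "0 < content_bound" using D(1) by (simp add: content_bound_def)
  show ?thesis
  \<comment> \<open>Both constants are computed from \<open>D\<close>, \<open>C\<close> and
    \<open>\<Lambda>\<close>, so they precede the points and the family.\<close>
  proof (rule exI[of _ tame_const], intro conjI \<kappa>, rule exI[of _ content_bound], intro conjI \<epsilon> allI impI)
    fix x y :: 'a and \<B> :: "('a \<times> real) set"
    assume xy: "x \<noteq> y" and pos: "\<forall>B\<in>\<B>. 0 < snd B"
      and disj: "{x, y} \<inter> (\<Union>B\<in>\<B>. ball_set (scale_ball 4 B)) = {}"
      and sum: "\<forall>r\<in>{0<..4 * dist x y}. \<forall>z\<in>{x, y}.
       (\<Sum>\<^sub>\<infinity>B\<in>{B\<in>\<B>. ball_set B \<inter> ball z r \<noteq> {}}. ball_content p \<mu> B)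
         \<le> ennreal content_bound * ball_content p \<mu> (z, r)"
    obtain \<gamma> where \<gamma>: "\<gamma> \<in> uniform_curves tame_const x y" "\<And>t. dist x (\<gamma> t) \<le> 7 / 4 * dist x y"
      "\<And>t. t \<in> {0..1} \<Longrightarrow> \<gamma> t \<notin> \<Union>(ball_set ` \<B>)"
    proof (rule uniform_curves_exist[of \<B> x y])
      show "z \<notin> ball (fst B) (4 * snd B)" if "B \<in> \<B>" "z \<in> {x, y}" for B z
        using disj that by (auto simp: ball_set_def scale_ball_def)
      show "small_content \<mu> p BB content_bound z (2 * dist x y)" 
        if "finite BB" "BB \<subseteq> \<B>" "z \<in> {x, y}" for BB z
        by (rule small_contentI[of BB \<B>]) (use that pos \<epsilon> sum in auto)
    qed (use xy pos in blast)+
    note props = uniform_curve_properties[OF \<gamma>(1) less_imp_le[OF \<kappa>]]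
    have ends: "\<gamma> 0 = x" "\<gamma> 1 = y" using \<gamma>(1) by (auto simp: uniform_curves_def)
    have d: "0 < dist x y" using xy by simp
    have "path_image \<gamma> \<subseteq> ball x (2 * dist x y)"
    proof
      fix u assume "u \<in> path_image \<gamma>"
      then obtain t where u: "u = \<gamma> t" by (auto simp: path_image_def)
      \<comment> \<open>The slack between \<open>7 / 4\<close> and 2 recovers the open ball from a
        closed bound that survived the limit.\<close>
      then show "u \<in> ball x (2 * dist x y)" using \<gamma>(2)[of t] d unfolding mem_ball u by linarith
    qed
    moreover have "path_image \<gamma> \<inter> (\<Union>B\<in>\<B>. ball_set B) = {}"
      using \<gamma>(3) by (fastforce simp: path_image_def)
    ultimately show "\<exists>\<gamma>. rectifiable_path \<gamma> \<and> \<gamma> 0 = x \<and> \<gamma> 1 = y \<and>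
       path_image \<gamma> \<inter> (\<Union>B\<in>\<B>. ball_set B) = {} \<and>
       path_image \<gamma> \<subseteq> ball x (2 * dist x y) \<and>
       curve_length \<gamma> 0 1 \<le> ennreal (tame_const * dist x y) \<and>
       (\<forall>t\<in>{0..1}.
          curve_length \<gamma> 0 t \<le> ennreal (tame_const * dist (\<gamma> t) x) \<and>
          curve_length \<gamma> t 1 \<le> ennreal (tame_const * dist (\<gamma> t) y))"
      using ends props by blast
  qed
qed

end
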